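(* Let $\phi:(\mathbb{C}^n,0)\to(\mathbb{C}^p,0)$ be a holomorphic map germ whose zero set $(X,0)$ is an ICIS. Then the monodromy with respect to $L$ is independent of the choice of the generic line $L\in\Omega$. That is, let $\mathring B_\delta\smallsetminus\Delta$ be the base of the Milnor fibration of $\phi$ and let $F_y=B_\epsilon\cap\phi^{-1}(y)$ be its fibre over $y$. If $L,L'\in\Omega$ are generic lines, with monodromies $h_L:H_*(F_y)\to H_*(F_y)$ and $h_{L'}:H_*(F_{y'})\to H_*(F_{y'})$ for base points $y\in L$ and $y'\in L'$ sufficiently close to the origin, then there is a path in $\mathring B_\delta\smallsetminus\Delta$ from $y$ to $y'$ such that the isomorphism $H_*(F_y)\to H_*(F_{y'})$ it induces conjugates $h_L$ into $h_{L'}$.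
   Context: The zero locus $(X,0)$ of $\phi:(\mathbb{C}^n,0)\to(\mathbb{C}^p,0)$ is an isolated complete intersection singularity (ICIS) if it has dimension $d=n-p$ and $\phi$ is a submersion at every point of $X\smallsetminus\{0\}$ near $0$. Let $\Sigma$ be the set germ of critical points of $\phi$ and $\Delta=\phi(\Sigma)$ its discriminant, which is a hypersurface in $(\mathbb{C}^p,0)$. Let $B_\epsilon\subset\mathbb{C}^n$ be the closed ball of radius $\epsilon$ and $\mathring B_\delta\subset\mathbb{C}^p$ the open ball of radius $\delta$, both centred at the origin. Choose $0<\delta\ll\epsilon\ll1$ such that $\phi:B_\epsilon\cap\phi^{-1}(\mathring B_\delta\smallsetminus\Delta)\to\mathring B_\delta\smallsetminus\Delta$ is a proper submersion (of manifolds with boundary) and $\mathring B_\delta\smallsetminus\Delta$ is connected. This map is then a smooth fibre bundle (the Milnor fibration), whose fibre $F=B_\epsilon\cap\phi^{-1}(y)$, $y\in\mathring B_\delta\smallsetminus\Delta$, is the Milnor fibre of $(X,0)$. A path in $\mathring B_\delta\smallsetminus\Delta$ induces an isomorphism between the homology groups of the fibres over its end points. In particular there is a monodromy action $\pi_1(\mathring B_\delta\smallsetminus\Delta;y)\to\operatorname{Aut}(H_*(F))$, and a change of base point changes it by conjugation with the isomorphism induced by a path between the base points. A line $L$ in $\mathbb{C}^p$ through the origin is generic if, as set germs, $L\cap\Delta=\{0\}$ and $L\cap C_0(\Delta)=\{0\}$. Here $C_0(\Delta)$ is the Zariski tangent cone of $\Delta$ at the origin, i.e. the zero set of the lowest-degree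 homogeneous part of a reduced equation of $\Delta$. The set of generic lines is denoted by $\Omega\subset\mathbb{P}^{p-1}$. The monodromy with respect to a generic line $L$ is the monodromy $H_*(F)\to H_*(F)$ of the smooth fibre bundle $\phi:B_\epsilon\cap\phi^{-1}(\partial B_\eta\cap L)\to\partial B_\eta\cap L$, for $\eta>0$ small enough ($B_\eta\subset\mathbb{C}^p$ being the closed ball of radius $\eta$), induced by the loop $\alpha_y(\theta)=e^{2\pi i\theta}y$, $\theta\in[0,1]$, for some $y\in\partial B_\eta\cap L$. *)

theory Defs
  imports "HOL-Analysis.Analysis" "HOL-Homology.Homology"
begin

text \<open>
  Points of \<open>\<complex>\<^sup>n\<close> are vectors of type \<open>complex ^ 'n\<close>, with the Euclidean norm;
  \<open>vec.subspace\<close> and \<open>vec.dim\<close> refer to the complex vector space structure given by \<open>*s\<close>,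
  while \<open>\<bullet>\<close> is the underlying real inner product. All germs are germs at the origin.
\<close>


section \<open>Holomorphic maps and germs\<close>

definition holomorphic_map_on ::
    "(complex ^ 'n \<Rightarrow> complex ^ 'p) \<Rightarrow> (complex ^ 'n) set \<Rightarrow> bool" where
  "holomorphic_map_on f U \<longleftrightarrow>
     (\<forall>z\<in>U. \<exists>A :: complex ^ 'n ^ 'p. (f has_derivative (\<lambda>v. A *v v)) (at z))"

definition holomorphic_fun_on :: "(complex ^ 'p \<Rightarrow> complex) \<Rightarrow> (complex ^ 'p) set \<Rightarrow> bool" where
  "holomorphic_fun_on g U \<longleftrightarrow>
     (\<forall>z\<in>U. \<exists>a :: complex ^ 'p. (g has_derivative (\<lambda>v. \<Sum>i\<in>UNIV. a $ i * v $ i)) (at z))"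

definition holomorphic_germ :: "(complex ^ 'p \<Rightarrow> complex) \<Rightarrow> bool" where
  "holomorphic_germ g \<longleftrightarrow> (\<exists>V. open V \<and> 0 \<in> V \<and> holomorphic_fun_on g V)"

definition germ_eq :: "(complex ^ 'p) set \<Rightarrow> (complex ^ 'p) set \<Rightarrow> bool" where
  "germ_eq A B \<longleftrightarrow> (\<forall>\<^sub>F z in nhds 0. z \<in> A \<longleftrightarrow> z \<in> B)"

definition germ_dvd :: "(complex ^ 'p \<Rightarrow> complex) \<Rightarrow> (complex ^ 'p \<Rightarrow> complex) \<Rightarrow> bool" where
  "germ_dvd g f \<longleftrightarrow> (\<exists>h. holomorphic_germ h \<and> (\<forall>\<^sub>F z in nhds 0. f z = h z * g z))"


section \<open>Isolated complete intersection singularities\<close>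

text \<open>\<open>X\<close> is a \<open>k\<close>-dimensional complex submanifold near \<open>z\<close>: some biholomorphic
  chart \<open>f\<close>, with inverse \<open>g\<close>, straightens it to a \<open>k\<close>-dimensional linear subspace \<open>T\<close>.\<close>

definition regular_point :: "(complex ^ 'n) set \<Rightarrow> nat \<Rightarrow> complex ^ 'n \<Rightarrow> bool" where
  "regular_point X k z \<longleftrightarrow> z \<in> X \<and>
     (\<exists>W f g T. open W \<and> z \<in> W \<and> open (f ` W) \<and>
        holomorphic_map_on (f :: complex ^ 'n \<Rightarrow> complex ^ 'n) W \<and>
        holomorphic_map_on (g :: complex ^ 'n \<Rightarrow> complex ^ 'n) (f ` W) \<and>
        (\<forall>w\<in>W. g (f w) = w) \<and>
        vec.subspace T \<and> vec.dim T = k \<and> f ` (X \<inter> W) = T \<inter> f ` W)"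

text \<open>The dimension at the origin of an analytic set: the largest dimension that \<open>X\<close> has at
  regular points arbitrarily close to the origin.\<close>

definition germ_dim :: "(complex ^ 'n) set \<Rightarrow> nat" where
  "germ_dim X = Max {k. \<forall>r>0. \<exists>z \<in> ball 0 r. regular_point X k z}"

definition submersion_at :: "(complex ^ 'n \<Rightarrow> complex ^ 'p) \<Rightarrow> complex ^ 'n \<Rightarrow> bool" where
  "submersion_at \<phi> z \<longleftrightarrow> (\<exists>D. (\<phi> has_derivative D) (at z) \<and> surj D)"

text \<open>The difference \<open>n - p\<close> is taken in the integers, so that \<open>n < p\<close> is excluded.\<close>

definition icis :: "(complex ^ 'n \<Rightarrow> complex ^ 'p) \<Rightarrow> (complex ^ 'n) set \<Rightarrow> bool" where
  "icis \<phi> U \<longleftrightarrow>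
     int (germ_dim {z \<in> U. \<phi> z = 0}) = int CARD('n) - int CARD('p) \<and>
     (\<exists>r>0. \<forall>z \<in> U \<inter> ball 0 r. \<phi> z = 0 \<and> z \<noteq> 0 \<longrightarrow> submersion_at \<phi> z)"


section \<open>The discriminant and generic lines\<close>

text \<open>The representative \<open>\<phi> (\<Sigma> \<inter> B\<^sub>\<epsilon>)\<close> of the discriminant. For an ICIS \<open>\<Sigma>\<close> meets the zero
  locus at most in the origin, so the germ of this set does not depend on small \<open>\<epsilon>\<close>.\<close>

definition discriminant :: "(complex ^ 'n \<Rightarrow> complex ^ 'p) \<Rightarrow> real \<Rightarrow> (complex ^ 'p) set" where
  "discriminant \<phi> \<epsilon> = \<phi> ` {z \<in> cball 0 \<epsilon>. \<not> submersion_at \<phi> z}"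

text \<open>An equation \<open>g\<close> of the germ \<open>D\<close> is reduced if the ideal it generates in the ring of
  holomorphic germs is radical.\<close>

definition reduced_equation :: "(complex ^ 'p) set \<Rightarrow> (complex ^ 'p \<Rightarrow> complex) \<Rightarrow> bool" where
  "reduced_equation D g \<longleftrightarrow> holomorphic_germ g \<and> germ_eq D {z. g z = 0} \<and>
     (\<forall>f k. holomorphic_germ f \<and> germ_dvd g (\<lambda>z. f z ^ k) \<longrightarrow> germ_dvd g f)"

text \<open>The degree \<open>k\<close> part \<open>g\<^sub>k\<close> of the Taylor series of \<open>g\<close>, read off from
  \<open>g (t z) = (\<Sum>k. g\<^sub>k (z) t\<^sup>k)\<close>.\<close>

definition homogeneous_part :: "nat \<Rightarrow> (complex ^ 'p \<Rightarrow> complex) \<Rightarrow> complex ^ 'p \<Rightarrow> complex" where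
  "homogeneous_part k g z = (deriv ^^ k) (\<lambda>t. g (t *s z)) 0 / fact k"

definition initial_form :: "(complex ^ 'p \<Rightarrow> complex) \<Rightarrow> complex ^ 'p \<Rightarrow> complex" where
  "initial_form g = homogeneous_part (LEAST k. \<exists>z. homogeneous_part k g z \<noteq> 0) g"

text \<open>Reduced equations of the same germ differ by a unit, so the choice of \<open>g\<close> is immaterial.\<close>

definition tangent_cone :: "(complex ^ 'p) set \<Rightarrow> (complex ^ 'p) set" where
  "tangent_cone D = {z. \<exists>g. reduced_equation D g \<and> initial_form g z = 0}"

definition generic_line :: "(complex ^ 'p) set \<Rightarrow> (complex ^ 'p) set \<Rightarrow> bool" where
  "generic_line D L \<longleftrightarrow> vec.subspace L \<and> vec.dim L = 1 \<and>
     germ_eq (L \<inter> D) {0} \<and> germ_eq (L \<inter> tangent_cone D) {0}"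


section \<open>The Milnor fibration and its monodromy\<close>

definition milnor_base :: "(complex ^ 'n \<Rightarrow> complex ^ 'p) \<Rightarrow> real \<Rightarrow> real \<Rightarrow> (complex ^ 'p) set" where
  "milnor_base \<phi> \<epsilon> \<delta> = ball 0 \<delta> - discriminant \<phi> \<epsilon>"

text \<open>The total space is open in the closed ball, hence a manifold with boundary, the boundary
  being its part on the sphere. A submersion of manifolds with boundary is a submersion whose
  restriction to the boundary is a submersion as well; the tangent space of the sphere at \<open>z\<close>
  consists of the vectors orthogonal to \<open>z\<close>.\<close>

definition milnor_fibration :: "(complex ^ 'n \<Rightarrow> complex ^ 'p) \<Rightarrow> real \<Rightarrow> real \<Rightarrow> bool" where
  "milnor_fibration \<phi> \<epsilon> \<delta> \<longleftrightarrow>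
     (let B = milnor_base \<phi> \<epsilon> \<delta>; E = cball 0 \<epsilon> \<inter> \<phi> -` B in
        proper_map (top_of_set E) (top_of_set B) \<phi> \<and>
        (\<forall>z\<in>E. submersion_at \<phi> z) \<and>
        (\<forall>z \<in> E \<inter> sphere 0 \<epsilon>. \<exists>D. (\<phi> has_derivative D) (at z) \<and> D ` {v. z \<bullet> v = 0} = UNIV) \<and>
        connected B)"

definition fibre :: "(complex ^ 'n \<Rightarrow> complex ^ 'p) \<Rightarrow> real \<Rightarrow> complex ^ 'p \<Rightarrow> (complex ^ 'n) set" where
  "fibre \<phi> \<epsilon> y = {x \<in> cball 0 \<epsilon>. \<phi> x = y}"

text \<open>A trivialisation, over the unit interval, of the pull-back of the fibration along the
  path \<open>\<gamma>\<close>, starting with the identity of the fibre over \<open>\<gamma> 0\<close>.\<close>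

definition path_trivialisation ::
    "(complex ^ 'n \<Rightarrow> complex ^ 'p) \<Rightarrow> real \<Rightarrow> (real \<Rightarrow> complex ^ 'p) \<Rightarrow>
     (real \<Rightarrow> complex ^ 'n \<Rightarrow> complex ^ 'n) \<Rightarrow> bool" where
  "path_trivialisation \<phi> \<epsilon> \<gamma> \<Psi> \<longleftrightarrow>
     homeomorphic_map
       (top_of_set (fibre \<phi> \<epsilon> (\<gamma> 0) \<times> {0..1}))
       (top_of_set {(x, t). t \<in> {0..1} \<and> x \<in> fibre \<phi> \<epsilon> (\<gamma> t)})
       (\<lambda>(x, t). (\<Psi> t x, t)) \<and>
     (\<forall>x \<in> fibre \<phi> \<epsilon> (\<gamma> 0). \<Psi> 0 x = x)"

abbreviation fibre_homology ::
    "(complex ^ 'n \<Rightarrow> complex ^ 'p) \<Rightarrow> real \<Rightarrow> int \<Rightarrow> complex ^ 'p \<Rightarrow> (complex ^ 'n) chain set monoid" where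
  "fibre_homology \<phi> \<epsilon> q y \<equiv> homology_group q (top_of_set (fibre \<phi> \<epsilon> y))"

text \<open>The map that \<open>\<gamma>\<close> induces on the \<open>q\<close>-th homology of the fibres over its end points. Any two
  trivialisations yield homotopic maps of fibres, and \<open>hom_induced\<close> has a fixed value off the
  carrier, so the description is unique as soon as a trivialisation exists.\<close>

definition homology_transport ::
    "(complex ^ 'n \<Rightarrow> complex ^ 'p) \<Rightarrow> real \<Rightarrow> int \<Rightarrow> (real \<Rightarrow> complex ^ 'p) \<Rightarrow>
     (complex ^ 'n) chain set \<Rightarrow> (complex ^ 'n) chain set" where
  "homology_transport \<phi> \<epsilon> q \<gamma> =
     (THE h. \<exists>\<Psi>. path_trivialisation \<phi> \<epsilon> \<gamma> \<Psi> \<and>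
        h = hom_induced q (top_of_set (fibre \<phi> \<epsilon> (\<gamma> 0))) {} (top_of_set (fibre \<phi> \<epsilon> (\<gamma> 1))) {} (\<Psi> 1))"

text \<open>The monodromy with respect to the line through \<open>y \<noteq> 0\<close>, with base point \<open>y\<close>.\<close>

definition line_monodromy ::
    "(complex ^ 'n \<Rightarrow> complex ^ 'p) \<Rightarrow> real \<Rightarrow> int \<Rightarrow> complex ^ 'p \<Rightarrow>
     (complex ^ 'n) chain set \<Rightarrow> (complex ^ 'n) chain set" where
  "line_monodromy \<phi> \<epsilon> q y =
     homology_transport \<phi> \<epsilon> q (\<lambda>\<theta>. exp (2 * of_real pi * \<i> * of_real \<theta>) *s y)"

end

theory Submission
  imports Defs "HOL-Complex_Analysis.Complex_Analysis"
begin

text \<open>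
  Let \<open>g\<close> be a reduced equation of the discriminant and let \<open>g\<^sub>k\<close> be its initial form. A generic line is
  spanned by a vector \<open>u\<close> with \<open>g\<^sub>k u \<noteq> 0\<close>. Given a second one, spanned by \<open>u'\<close>, the function \<open>g\<^sub>k\<close> restricted to
  the complex line through \<open>u\<close> and \<open>u'\<close> is holomorphic and not identically zero, so a path from \<open>u\<close> to \<open>u'\<close>
  avoids its countably many zeros. Since \<open>g (t z) = t\<^sup>k (g\<^sub>k z + O(t))\<close>, uniformly for \<open>z\<close> in compact
  sets, the punctured cone over this path is disjoint from the discriminant near the origin. Inside the
  cone, \<open>y\<close> and \<open>y'\<close> are joined by a path \<open>\<gamma>\<close> such that all the circles \<open>\<theta> \<mapsto> exp (2 \<pi> \<i> \<theta>) \<gamma> s\<close> stay in the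
  base of the Milnor fibration (\<open>path_avoiding_zeros_of_initial_form\<close>). These circles deform the loop
  at \<open>y\<close> into the loop at \<open>y'\<close> while the base point moves along \<open>\<gamma>\<close>, so transport along \<open>\<gamma>\<close> conjugates one
  monodromy into the other (\<open>transport_conjugates_monodromy\<close>).

  Transport is realised by flows (\<open>parallel_transport\<close>). A vector field of the base is lifted to the
  closed ball by an explicit formula whose lifts are tangent to the bounding sphere
  (\<open>horizontal_lift_near_compact\<close>). By Cauchy's inequality the derivative of a holomorphic map is locally
  Lipschitz, hence so are the lifted fields, and the theorem of Picard and Lindeloef applies. The flow \<open>\<Psi>\<close>
  over \<open>\<gamma>\<close> lifts the velocity of \<open>\<gamma>\<close>; one further flow \<open>Y\<close>, which lifts the rotation field, trivialises the
  fibration over all the circles at once. The maps \<open>\<Psi>\<^sub>1 \<circ> inverse \<Psi>\<^sub>s \<circ> Y\<^sub>1 \<circ> \<Psi>\<^sub>s\<close> form a homotopy from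
  \<open>\<Psi>\<^sub>1 \<circ> Y\<^sub>1\<close> to \<open>Y\<^sub>1 \<circ> \<Psi>\<^sub>1\<close>. A homotopy of the same kind shows that the map in homology does not depend on the
  chosen trivialisation (\<open>homology_transport_eq\<close>).
\<close>


section \<open>Ordinary differential equations\<close>

text \<open>Multiplied by \<open>exp (-K t)\<close> the function \<open>u\<close> decreases, multiplied by \<open>exp (K t)\<close> it
  increases. Having Gronwall's bound in both time directions gives the uniqueness of solutions through
  a point at any time, and the injectivity of the flow.\<close>

lemma growth_bound_two_sided:
  fixes u u' :: "real \<Rightarrow> real"
  assumes der: "\<And>t. t \<in> {a..b} \<Longrightarrow> (u has_real_derivative u' t) (at t within {a..b})"
    and bound: "\<And>t. t \<in> {a..b} \<Longrightarrow> \<bar>u' t\<bar> \<le> K * u t"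
    and st: "a \<le> s" "s \<le> t" "t \<le> b"
  shows "u t \<le> u s * exp (K * (t - s))" "u s \<le> u t * exp (K * (t - s))"
proof -
  have cont: "continuous_on {s..t} u"
    by (rule continuous_on_subset[OF DERIV_continuous_on[OF der]]) (use st in auto)
  have der': "(u has_real_derivative u' x) (at x)" if "s < x" "x < t" for x
  proof -
    have "at x within {a..b} = at x"
      by (rule at_within_interior) (use that st in auto)
    then show ?thesis using der[of x] that st by simp
  qed
  have "u s * exp (- K * s) \<ge> u t * exp (- K * t)"
  proof (rule DERIV_nonpos_imp_decreasing_open[OF st(2)])
    fix x assume x: "s < x" "x < t"
    have "((\<lambda>t. u t * exp (- K * t)) has_real_derivative (u' x - K * u x) * exp (- K * x)) (at x)"
      by (auto intro!: derivative_eq_intros der' x simp: algebra_simps)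
    moreover have "u' x - K * u x \<le> 0" using bound[of x] x st by auto
    ultimately show "\<exists>y. ((\<lambda>t. u t * exp (- K * t)) has_real_derivative y) (at x) \<and> y \<le> 0"
      using mult_nonpos_nonneg by (metis exp_ge_zero)
  qed (auto intro!: continuous_intros cont)
  then have "u t * exp (- K * t) * exp (K * t) \<le> u s * exp (- K * s) * exp (K * t)"
    by (intro mult_right_mono) auto
  then show "u t \<le> u s * exp (K * (t - s))"
    by (simp add: mult.assoc flip: exp_add) (simp add: algebra_simps)
  have "u s * exp (K * s) \<le> u t * exp (K * t)"
  proof (rule DERIV_nonneg_imp_increasing_open[OF st(2)])
    fix x assume x: "s < x" "x < t"
    have "((\<lambda>t. u t * exp (K * t)) has_real_derivative (u' x + K * u x) * exp (K * x)) (at x)"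
      by (auto intro!: derivative_eq_intros der' x simp: algebra_simps)
    moreover have "u' x + K * u x \<ge> 0" using bound[of x] x st by auto
    ultimately show "\<exists>y. ((\<lambda>t. u t * exp (K * t)) has_real_derivative y) (at x) \<and> y \<ge> 0"
      using mult_nonneg_nonneg by (metis exp_ge_zero)
  qed (auto intro!: continuous_intros cont)
  then have "u s * exp (K * s) * exp (- K * s) \<le> u t * exp (K * t) * exp (- K * s)"
    by (intro mult_right_mono) auto
  then show "u s \<le> u t * exp (K * (t - s))"
    by (simp add: mult.assoc flip: exp_add) (simp add: algebra_simps)
qed

definition solves_ode ::
    "(real \<Rightarrow> 'a \<Rightarrow> 'a::real_normed_vector) \<Rightarrow> real \<Rightarrow> real \<Rightarrow> (real \<Rightarrow> 'a) \<Rightarrow> bool" where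
  "solves_ode f a b x \<longleftrightarrow> (\<forall>t\<in>{a..b}. (x has_vector_derivative f t (x t)) (at t within {a..b}))"

lemma solves_odeD:
  "solves_ode f a b x \<Longrightarrow> t \<in> {a..b} \<Longrightarrow> (x has_vector_derivative f t (x t)) (at t within {a..b})"
  by (auto simp: solves_ode_def)

lemma solves_ode_subinterval:
  "solves_ode f a b x \<Longrightarrow> a \<le> c \<Longrightarrow> d \<le> b \<Longrightarrow> solves_ode f c d x"
  unfolding solves_ode_def
  by (meson atLeastatMost_subset_iff has_vector_derivative_within_subset subset_iff)

lemma solves_ode_continuous_on: "solves_ode f a b x \<Longrightarrow> continuous_on {a..b} x"
  unfolding solves_ode_def
  by (meson continuous_on_eq_continuous_within has_vector_derivative_continuous)

lemma has_real_derivative_norm_square: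
  fixes x :: "real \<Rightarrow> 'a::real_inner"
  assumes "(x has_vector_derivative x') (at t within S)"
  shows "((\<lambda>t. (norm (x t))\<^sup>2) has_real_derivative 2 * (x t \<bullet> x')) (at t within S)"
proof -
  have "((\<lambda>t. x t \<bullet> x t) has_derivative (\<lambda>h. x t \<bullet> (h *\<^sub>R x') + (h *\<^sub>R x') \<bullet> x t)) (at t within S)"
    using assms unfolding has_vector_derivative_def by (intro has_derivative_inner)
  then show ?thesis
    unfolding has_field_derivative_def power2_norm_eq_inner
    by (rule has_derivative_eq_rhs) (auto simp: inner_commute)
qed

text \<open>Gronwall's bound for the squared distance, which is differentiable even where the two
  solutions meet.\<close>

lemma solves_ode_growth:
  fixes x y :: "real \<Rightarrow> 'a::real_inner"
  assumes x: "solves_ode f a b x" and y: "solves_ode f a b y"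
    and lip: "\<And>t. t \<in> {a..b} \<Longrightarrow> norm (f t (x t) - f t (y t)) \<le> L * norm (x t - y t)"
    and st: "a \<le> s" "s \<le> t" "t \<le> b"
  shows "(norm (x t - y t))\<^sup>2 \<le> (norm (x s - y s))\<^sup>2 * exp (2 * L * (t - s))"
        "(norm (x s - y s))\<^sup>2 \<le> (norm (x t - y t))\<^sup>2 * exp (2 * L * (t - s))"
proof -
  let ?u = "\<lambda>t. (norm (x t - y t))\<^sup>2"
  let ?u' = "\<lambda>t. 2 * ((x t - y t) \<bullet> (f t (x t) - f t (y t)))"
  have der: "(?u has_real_derivative ?u' t) (at t within {a..b})" if "t \<in> {a..b}" for t
    by (intro has_real_derivative_norm_square has_vector_derivative_diff solves_odeD[OF x]
        solves_odeD[OF y] that)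
  have bound: "\<bar>?u' t\<bar> \<le> 2 * L * ?u t" if "t \<in> {a..b}" for t
  proof -
    have "\<bar>(x t - y t) \<bullet> (f t (x t) - f t (y t))\<bar> \<le> norm (x t - y t) * norm (f t (x t) - f t (y t))"
      by (rule Cauchy_Schwarz_ineq2)
    also have "\<dots> \<le> norm (x t - y t) * (L * norm (x t - y t))"
      using lip[OF that] by (intro mult_left_mono) auto
    finally show ?thesis by (simp add: power2_eq_square mult_ac)
  qed
  show "?u t \<le> ?u s * exp (2 * L * (t - s))" "?u s \<le> ?u t * exp (2 * L * (t - s))"
    using growth_bound_two_sided[OF der bound st] by auto
qed

corollary solves_ode_unique:
  fixes x y :: "real \<Rightarrow> 'a::real_inner"
  assumes x: "solves_ode f a b x" and y: "solves_ode f a b y"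
    and lip: "\<And>t. t \<in> {a..b} \<Longrightarrow> norm (f t (x t) - f t (y t)) \<le> L * norm (x t - y t)"
    and s: "s \<in> {a..b}" "x s = y s" and t: "t \<in> {a..b}"
  shows "x t = y t"
proof (cases "s \<le> t")
  case True
  then show ?thesis using solves_ode_growth(1)[OF x y lip, of s t] s t by simp
next
  case False
  then show ?thesis using solves_ode_growth(2)[OF x y lip, of t s] s t by simp
qed

lemma continuous_on_Lipschitz_family:
  fixes f :: "real \<Rightarrow> 'a::real_normed_vector \<Rightarrow> 'b::real_normed_vector"
  assumes cont: "\<And>x. continuous_on S (\<lambda>t. f t x)"
    and lip: "\<And>t x y. t \<in> S \<Longrightarrow> norm (f t x - f t y) \<le> L * norm (x - y)"
    and x: "continuous_on S x"
  shows "continuous_on S (\<lambda>t. f t (x t))"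
  unfolding continuous_on_def
proof
  fix t assume t: "t \<in> S"
  have "((\<lambda>s. (f s (x s) - f s (x t)) + f s (x t)) \<longlongrightarrow> 0 + f t (x t)) (at t within S)"
  proof (intro tendsto_add)
    have "((\<lambda>s. L * norm (x s - x t)) \<longlongrightarrow> L * norm (x t - x t)) (at t within S)"
      using x t by (intro tendsto_intros) (auto simp: continuous_on_def)
    then have "((\<lambda>s. L * norm (x s - x t)) \<longlongrightarrow> 0) (at t within S)" by simp
    then show "((\<lambda>s. f s (x s) - f s (x t)) \<longlongrightarrow> 0) (at t within S)"
      by (rule Lim_null_comparison[rotated])
         (auto simp: eventually_at_filter lip intro!: always_eventually)
    show "((\<lambda>s. f s (x t)) \<longlongrightarrow> f t (x t)) (at t within S)"
      using cont t by (auto simp: continuous_on_def)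
  qed
  then show "((\<lambda>s. f s (x s)) \<longlongrightarrow> f t (x t)) (at t within S)" by simp
qed

text \<open>The \<open>n\<close>-th increment of the Picard iteration is at most
  \<open>M * L ^ n * t ^ (n + 1) / (n + 1)!\<close>. These bounds are summable for every \<open>t\<close>, so the iterates converge
  on the whole interval, however long it is.\<close>

theorem global_Picard_Lindeloef:
  fixes f :: "real \<Rightarrow> 'a::euclidean_space \<Rightarrow> 'a"
  assumes cont: "\<And>x. continuous_on {0..b} (\<lambda>t. f t x)"
    and lip: "\<And>t x y. t \<in> {0..b} \<Longrightarrow> norm (f t x - f t y) \<le> L * norm (x - y)"
    and L: "L \<ge> 0"
  obtains x where "x 0 = x0" "solves_ode f 0 b x"
proof -
  define X where "X = rec_nat (\<lambda>_. x0) (\<lambda>_ x t. x0 + integral {0..t} (\<lambda>s. f s (x s)))"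
  have X0: "X 0 = (\<lambda>_. x0)" and XS: "X (Suc n) = (\<lambda>t. x0 + integral {0..t} (\<lambda>s. f s (X n s)))" for n
    by (simp_all add: X_def)
  have fcont: "continuous_on {0..b} (\<lambda>t. f t (x t))" if "continuous_on {0..b} x" for x
    by (rule continuous_on_Lipschitz_family[OF cont lip that])
  have Xcont: "continuous_on {0..b} (X n)" for n
  proof (induction n)
    case (Suc n)
    then show ?case unfolding XS
      by (intro continuous_intros indefinite_integral_continuous_1 integrable_continuous_interval fcont)
  qed (simp add: X0)
  have int: "(\<lambda>s. f s (x s)) integrable_on {0..t}" if "continuous_on {0..b} x" "t \<in> {0..b}" for x t
    by (rule integrable_continuous_interval)
       (rule continuous_on_subset[OF fcont[OF that(1)]], use that in auto)
  obtain M where M: "\<And>t. t \<in> {0..b} \<Longrightarrow> norm (f t x0) \<le> M"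
    using compact_imp_bounded[OF compact_continuous_image[OF cont[of x0] compact_Icc]]
    unfolding bounded_iff by blast
  have step: "norm (X (Suc n) t - X n t) \<le> M * L ^ n * t ^ Suc n / fact (Suc n)" if "t \<in> {0..b}" for n t
    using that
  proof (induction n arbitrary: t)
    case 0
    have "norm (integral {0..t} (\<lambda>s. f s x0)) \<le> integral {0..t} (\<lambda>s. M)"
      using 0 M int[of "\<lambda>_. x0" t] by (intro integral_norm_bound_integral) auto
    then show ?case using 0 by (simp add: X0 XS mult.commute)
  next
    case (Suc n)
    have pw: "((\<lambda>s. L * (M * L ^ n * s ^ Suc n / fact (Suc n))) has_integral
        L * (M * L ^ n * t ^ Suc (Suc n) / fact (Suc (Suc n))) -
        L * (M * L ^ n * 0 ^ Suc (Suc n) / fact (Suc (Suc n)))) {0..t}"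
    proof (rule fundamental_theorem_of_calculus)
      fix s :: real
      have "((\<lambda>s. L * (M * L ^ n * s ^ Suc (Suc n) / fact (Suc (Suc n)))) has_real_derivative
            L * (M * L ^ n * (real (Suc (Suc n)) * s ^ Suc n) / fact (Suc (Suc n)))) (at s within {0..t})"
        using DERIV_pow[of "Suc (Suc n)" s "{0..t}"] by (intro DERIV_cmult DERIV_cdivide) simp
      also have "L * (M * L ^ n * (real (Suc (Suc n)) * s ^ Suc n) / fact (Suc (Suc n)))
          = L * (M * L ^ n * s ^ Suc n / fact (Suc n))"
        by (simp only: fact_Suc[of "Suc n"]) (simp add: divide_simps del: fact_Suc)
      finally show "((\<lambda>s. L * (M * L ^ n * s ^ Suc (Suc n) / fact (Suc (Suc n)))) has_vector_derivative
          L * (M * L ^ n * s ^ Suc n / fact (Suc n))) (at s within {0..t})"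
        by (simp only: has_real_derivative_iff_has_vector_derivative)
    qed (use Suc in auto)
    have "norm (integral {0..t} (\<lambda>s. f s (X (Suc n) s) - f s (X n s)))
        \<le> integral {0..t} (\<lambda>s. L * (M * L ^ n * s ^ Suc n / fact (Suc n)))"
    proof (intro integral_norm_bound_integral)
      fix s assume s: "s \<in> {0..t}"
      then have s': "s \<in> {0..b}" using Suc by auto
      have "norm (f s (X (Suc n) s) - f s (X n s)) \<le> L * norm (X (Suc n) s - X n s)"
        using lip s' by blast
      also have "\<dots> \<le> L * (M * L ^ n * s ^ Suc n / fact (Suc n))"
        using Suc.IH[OF s'] L by (intro mult_left_mono)
      finally show "norm (f s (X (Suc n) s) - f s (X n s)) \<le> L * (M * L ^ n * s ^ Suc n / fact (Suc n))" .
    qed (use pw int[OF Xcont Suc.prems] in \<open>auto intro!: integrable_diff\<close>)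
    also have "\<dots> = M * L ^ Suc n * t ^ Suc (Suc n) / fact (Suc (Suc n))"
      using integral_unique[OF pw] by (simp add: mult_ac)
    also have "integral {0..t} (\<lambda>s. f s (X (Suc n) s) - f s (X n s)) =
        (x0 + integral {0..t} (\<lambda>s. f s (X (Suc n) s))) - (x0 + integral {0..t} (\<lambda>s. f s (X n s)))"
      by (simp add: integral_diff[OF int[OF Xcont Suc.prems] int[OF Xcont Suc.prems]])
    also have "\<dots> = X (Suc (Suc n)) t - X (Suc n) t"
      by (simp only: XS[THEN fun_cong, of _ t])
    finally show ?case .
  qed
  define A where "A n = M * b * ((L * b) ^ n / fact n)" for n
  have M0: "M \<ge> 0" if "b \<ge> 0" using order_trans[OF norm_ge_zero M[of 0]] that by auto
  have bound: "norm (X (Suc n) t - X n t) \<le> A n" if t: "t \<in> {0..b}" for n t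
  proof -
    have b: "b \<ge> 0" using t by auto
    have "M * L ^ n * t ^ Suc n / fact (Suc n) \<le> M * L ^ n * b ^ Suc n / fact n"
      using t b M0 L by (intro frac_le mult_left_mono power_mono mult_nonneg_nonneg) (auto intro!: fact_mono)
    then show ?thesis using step[OF t, of n] by (simp add: A_def power_mult_distrib mult_ac)
  qed
  have "summable A" unfolding A_def by (intro summable_mult) (simp add: summable_exp divide_inverse mult.commute)
  then have "uniform_limit {0..b} (\<lambda>n t. \<Sum>i<n. X (Suc i) t - X i t)
      (\<lambda>t. suminf (\<lambda>i. X (Suc i) t - X i t)) sequentially"
    using bound by (intro Weierstrass_m_test) auto
  moreover have "(\<Sum>i<n. X (Suc i) t - X i t) = X n t - X 0 t" for n t
    by (rule sum_lessThan_telescope)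
  ultimately have "uniform_limit {0..b} (\<lambda>n t. x0 + (X n t - X 0 t))
      (\<lambda>t. x0 + suminf (\<lambda>i. X (Suc i) t - X i t)) sequentially"
    by (intro uniform_limit_intros) simp
  then obtain x where ul: "uniform_limit {0..b} X x sequentially" by (auto simp: X0)
  have xcont: "continuous_on {0..b} x"
    by (rule uniform_limit_theorem[OF _ ul]) (auto simp: Xcont)
  have eq: "x t = x0 + integral {0..t} (\<lambda>s. f s (x s))" if t: "t \<in> {0..b}" for t
  proof (rule LIMSEQ_unique)
    show "(\<lambda>n. X (Suc n) t) \<longlonglongrightarrow> x t"
      using tendsto_uniform_limitI[OF ul t] by (rule LIMSEQ_Suc)
    have "uniform_limit {0..t} (\<lambda>n s. f s (X n s)) (\<lambda>s. f s (x s)) sequentially"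
    proof (rule uniform_limitI)
      fix e :: real assume e: "e > 0"
      have "\<forall>\<^sub>F n in sequentially. \<forall>s\<in>{0..b}. dist (X n s) (x s) < e / (L + 1)"
        by (rule uniform_limitD[OF ul]) (use e L in auto)
      then show "\<forall>\<^sub>F n in sequentially. \<forall>s\<in>{0..t}. dist (f s (X n s)) (f s (x s)) < e"
      proof eventually_elim
        case (elim n)
        show ?case
        proof
          fix s assume "s \<in> {0..t}"
          then have s: "s \<in> {0..b}" using t by auto
          have "norm (f s (X n s) - f s (x s)) \<le> L * norm (X n s - x s)" by (rule lip[OF s])
          also have "\<dots> \<le> L * (e / (L + 1))"
            using elim s L by (intro mult_left_mono) (auto simp: dist_norm intro: less_imp_le)
          also have "\<dots> < e" using e L by (simp add: field_simps)
          finally show "dist (f s (X n s)) (f s (x s)) < e" by (simp add: dist_norm)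
        qed
      qed
    qed
    moreover have "continuous_on {0..t} (\<lambda>s. f s (X n s))" for n
      using t by (intro continuous_on_subset[OF fcont[OF Xcont]]) auto
    ultimately have "\<exists>I J. (\<forall>n. ((\<lambda>s. f s (X n s)) has_integral I n) {0..t}) \<and>
        ((\<lambda>s. f s (x s)) has_integral J) {0..t} \<and> I \<longlonglongrightarrow> J"
      by (rule uniform_limit_integral[OF _ _ sequentially_bot]) auto
    then obtain I J where I: "\<And>n. ((\<lambda>s. f s (X n s)) has_integral I n) {0..t}"
        and J: "((\<lambda>s. f s (x s)) has_integral J) {0..t}" and lim: "I \<longlonglongrightarrow> J"
      by blast
    have "(\<lambda>n. integral {0..t} (\<lambda>s. f s (X n s))) \<longlonglongrightarrow> integral {0..t} (\<lambda>s. f s (x s))"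
      unfolding integral_unique[OF I] integral_unique[OF J] by (rule lim)
    then show "(\<lambda>n. X (Suc n) t) \<longlonglongrightarrow> x0 + integral {0..t} (\<lambda>s. f s (x s))"
      unfolding XS by (intro tendsto_intros)
  qed
  define y where "y t = x0 + integral {0..t} (\<lambda>s. f s (x s))" for t
  have "solves_ode f 0 b y"
    unfolding solves_ode_def
  proof
    fix t assume t: "t \<in> {0..b}"
    have "(y has_vector_derivative 0 + f t (x t)) (at t within {0..b})"
      unfolding y_def
      by (intro has_vector_derivative_add has_vector_derivative_const
          integral_has_vector_derivative[OF fcont[OF xcont] t])
    then show "(y has_vector_derivative f t (y t)) (at t within {0..b})"
      using eq[OF t] by (simp add: y_def)
  qed
  moreover have "y 0 = x0" by (simp add: y_def)
  ultimately show ?thesis using that by blast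
qed


section \<open>Bounded Lipschitz maps\<close>

text \<open>Bounds and Lipschitz constants are kept together because the Lipschitz property alone is not
  stable under products.\<close>

definition bdd_lipschitz_on ::
    "'a::metric_space set \<Rightarrow> ('a \<Rightarrow> 'b::real_normed_vector) \<Rightarrow> bool" where
  "bdd_lipschitz_on N F \<longleftrightarrow> (\<exists>M. \<forall>x\<in>N. norm (F x) \<le> M) \<and> (\<exists>L. L-lipschitz_on N F)"

lemma bdd_lipschitz_onE:
  assumes "bdd_lipschitz_on N F"
  obtains M L where "M \<ge> 0" "L \<ge> 0" "\<And>x. x \<in> N \<Longrightarrow> norm (F x) \<le> M"
    "\<And>x y. x \<in> N \<Longrightarrow> y \<in> N \<Longrightarrow> norm (F x - F y) \<le> L * dist x y"
proof -
  obtain M L where bnd: "\<forall>x\<in>N. norm (F x) \<le> M" "L-lipschitz_on N F"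
    using assms by (auto simp: bdd_lipschitz_on_def)
  show ?thesis
    by (rule that[of "max M 0" L])
       (use bnd in \<open>auto simp: dist_norm[symmetric] lipschitz_on_nonneg intro: lipschitz_onD\<close>)
qed

lemma bdd_lipschitz_onI:
  assumes "\<And>x. x \<in> N \<Longrightarrow> norm (F x) \<le> M"
    and "\<And>x y. x \<in> N \<Longrightarrow> y \<in> N \<Longrightarrow> norm (F x - F y) \<le> L * dist x y"
  shows "bdd_lipschitz_on N F"
  unfolding bdd_lipschitz_on_def
proof
  have "(max L 0)-lipschitz_on N F"
  proof (rule lipschitz_onI)
    fix x y assume "x \<in> N" "y \<in> N"
    then have "norm (F x - F y) \<le> L * dist x y" using assms by blast
    also have "\<dots> \<le> max L 0 * dist x y" by (intro mult_right_mono) auto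
    finally show "dist (F x) (F y) \<le> max L 0 * dist x y" by (simp add: dist_norm)
  qed auto
  then show "\<exists>L. L-lipschitz_on N F" by blast
qed (use assms in blast)

lemma bdd_lipschitz_on_subset:
  "bdd_lipschitz_on N F \<Longrightarrow> N' \<subseteq> N \<Longrightarrow> bdd_lipschitz_on N' F"
  unfolding bdd_lipschitz_on_def by (meson lipschitz_on_subset subsetD)

lemma bdd_lipschitz_on_continuous: "bdd_lipschitz_on N F \<Longrightarrow> continuous_on N F"
  unfolding bdd_lipschitz_on_def using lipschitz_on_continuous_on by blast

lemma bdd_lipschitz_on_const: "bdd_lipschitz_on N (\<lambda>_. c)"
  by (rule bdd_lipschitz_onI[of _ _ "norm c" 0]) auto

lemma bdd_lipschitz_on_diff:
  assumes "bdd_lipschitz_on N F" "bdd_lipschitz_on N G"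
  shows "bdd_lipschitz_on N (\<lambda>x. F x - G x)"
proof -
  obtain M L where F: "\<And>x. x \<in> N \<Longrightarrow> norm (F x) \<le> M"
    "\<And>x y. x \<in> N \<Longrightarrow> y \<in> N \<Longrightarrow> norm (F x - F y) \<le> L * dist x y"
    using assms(1) by (elim bdd_lipschitz_onE) blast
  obtain M' L' where G: "\<And>x. x \<in> N \<Longrightarrow> norm (G x) \<le> M'"
    "\<And>x y. x \<in> N \<Longrightarrow> y \<in> N \<Longrightarrow> norm (G x - G y) \<le> L' * dist x y"
    using assms(2) by (elim bdd_lipschitz_onE) blast
  show ?thesis
  proof (rule bdd_lipschitz_onI[of _ _ "M + M'" "L + L'"])
    fix x assume x: "x \<in> N"
    show "norm (F x - G x) \<le> M + M'"
      using F(1)[OF x] G(1)[OF x] norm_triangle_ineq4[of "F x" "G x"] by simp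
    fix y assume y: "y \<in> N"
    have "norm ((F x - G x) - (F y - G y)) \<le> norm (F x - F y) + norm (G x - G y)"
      using norm_triangle_ineq4[of "F x - F y" "G x - G y"] by (simp add: algebra_simps)
    also have "\<dots> \<le> (L + L') * dist x y"
      using F(2)[OF x y] G(2)[OF x y] by (simp add: algebra_simps)
    finally show "norm ((F x - G x) - (F y - G y)) \<le> (L + L') * dist x y" .
  qed
qed

lemma bdd_lipschitz_on_bilinear:
  assumes "bounded_bilinear h" "bdd_lipschitz_on N F" "bdd_lipschitz_on N G"
  shows "bdd_lipschitz_on N (\<lambda>x. h (F x) (G x))"
proof -
  interpret bounded_bilinear h by fact
  obtain K where K: "K > 0" "\<And>a b. norm (h a b) \<le> norm a * norm b * K"
    using pos_bounded by blast
  obtain M L where F: "M \<ge> 0" "L \<ge> 0" "\<And>x. x \<in> N \<Longrightarrow> norm (F x) \<le> M"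
    "\<And>x y. x \<in> N \<Longrightarrow> y \<in> N \<Longrightarrow> norm (F x - F y) \<le> L * dist x y"
    using assms(2) by (elim bdd_lipschitz_onE) blast
  obtain M' L' where G: "M' \<ge> 0" "L' \<ge> 0" "\<And>x. x \<in> N \<Longrightarrow> norm (G x) \<le> M'"
    "\<And>x y. x \<in> N \<Longrightarrow> y \<in> N \<Longrightarrow> norm (G x - G y) \<le> L' * dist x y"
    using assms(3) by (elim bdd_lipschitz_onE) blast
  have est: "norm (h a b) \<le> A * B * K" if "norm a \<le> A" "norm b \<le> B" for a b A B
  proof -
    have "norm a * norm b * K \<le> A * B * K"
      using that K order_trans[OF norm_ge_zero that(1)] by (intro mult_right_mono mult_mono) auto
    then show ?thesis using K(2)[of a b] by simp
  qed
  show ?thesis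
  proof (rule bdd_lipschitz_onI[of _ _ "M * M' * K" "L * M' * K + M * L' * K"])
    fix x assume x: "x \<in> N"
    show "norm (h (F x) (G x)) \<le> M * M' * K" by (rule est[OF F(3)[OF x] G(3)[OF x]])
    fix y assume y: "y \<in> N"
    have "h (F x) (G x) - h (F y) (G y) = h (F x - F y) (G x) + h (F y) (G x - G y)"
      by (simp add: diff_left diff_right)
    then have "norm (h (F x) (G x) - h (F y) (G y)) \<le> (L * dist x y) * M' * K + M * (L' * dist x y) * K"
      using norm_triangle_ineq[of "h (F x - F y) (G x)" "h (F y) (G x - G y)"]
        est[OF F(4)[OF x y] G(3)[OF x]] est[OF F(3)[OF y] G(4)[OF x y]] by simp
    then show "norm (h (F x) (G x) - h (F y) (G y)) \<le> (L * M' * K + M * L' * K) * dist x y"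
      by (simp add: algebra_simps)
  qed
qed

lemma bdd_lipschitz_on_linear:
  assumes "bounded_linear h" "bdd_lipschitz_on N F"
  shows "bdd_lipschitz_on N (\<lambda>x. h (F x))"
proof -
  interpret bounded_linear h by fact
  obtain K where K: "K > 0" "\<And>a. norm (h a) \<le> norm a * K" using pos_bounded by blast
  obtain M L where F: "\<And>x. x \<in> N \<Longrightarrow> norm (F x) \<le> M"
    "\<And>x y. x \<in> N \<Longrightarrow> y \<in> N \<Longrightarrow> norm (F x - F y) \<le> L * dist x y"
    using assms(2) by (elim bdd_lipschitz_onE) blast
  show ?thesis
  proof (rule bdd_lipschitz_onI[of _ _ "M * K" "L * K"])
    fix x assume x: "x \<in> N"
    show "norm (h (F x)) \<le> M * K"
      by (rule order_trans[OF K(2)]) (intro mult_right_mono F(1) x less_imp_le K(1))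
    fix y assume y: "y \<in> N"
    show "norm (h (F x) - h (F y)) \<le> L * K * dist x y"
      using order_trans[OF K(2)[of "F x - F y"] mult_right_mono[OF F(2)[OF x y] less_imp_le[OF K(1)]]]
      by (simp add: diff mult_ac)
  qed
qed

lemma linear_blinfun_apply: "linear (blinfun_apply A)"
  by (rule bounded_linear.linear[OF blinfun.bounded_linear_right])

text \<open>Coercivity bounds the inverses uniformly by \<open>1 / c\<close>, and then
  \<open>S x (R x - R y) = (S y - S x) (R y)\<close> shows that they depend on \<open>x\<close> in a Lipschitz way.\<close>

lemma bdd_lipschitz_on_inverse:
  fixes S :: "'c::metric_space \<Rightarrow> 'b::euclidean_space \<Rightarrow>\<^sub>L 'b"
  assumes S: "bdd_lipschitz_on N S" and c: "c > 0"
    and coercive: "\<And>x v. x \<in> N \<Longrightarrow> c * (norm v)\<^sup>2 \<le> v \<bullet> S x v"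
  obtains R where "bdd_lipschitz_on N R" "\<And>x v. x \<in> N \<Longrightarrow> S x (blinfun_apply (R x) v) = v"
proof -
  obtain M L where L: "\<And>x y. x \<in> N \<Longrightarrow> y \<in> N \<Longrightarrow> norm (S x - S y) \<le> L * dist x y"
    using S by (elim bdd_lipschitz_onE) blast
  have low: "norm v \<le> norm (S x v) / c" if "x \<in> N" for x v
  proof (cases "v = 0")
    case False
    have "c * (norm v)\<^sup>2 \<le> norm v * norm (S x v)"
      using coercive[OF that, of v] norm_cauchy_schwarz[of v "S x v"] by simp
    then show ?thesis using False c by (simp add: power2_eq_square field_simps)
  qed simp
  have "\<exists>R::'b \<Rightarrow>\<^sub>L 'b. \<forall>v. S x (R v) = v" if x: "x \<in> N" for x
  proof -
    have lin: "linear (blinfun_apply (S x))" by (rule linear_blinfun_apply)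
    have "inj (blinfun_apply (S x))"
      unfolding linear_injective_0[OF lin]
    proof (intro allI impI)
      show "v = 0" if "blinfun_apply (S x) v = 0" for v using low[OF x, of v] that by simp
    qed
    then have "surj (blinfun_apply (S x))" by (rule linear_injective_imp_surjective[OF lin]) simp
    then obtain g where "linear g" "blinfun_apply (S x) \<circ> g = id"
      using linear_surjective_right_inverse[OF lin] by auto
    then show ?thesis
      by (intro exI[of _ "Blinfun g"])
         (auto simp: bounded_linear_Blinfun_apply linear_conv_bounded_linear fun_eq_iff)
  qed
  then obtain R where R: "\<And>x v. x \<in> N \<Longrightarrow> S x (blinfun_apply (R x) v) = v" by metis
  have bd: "norm (R x v) \<le> norm v / c" if "x \<in> N" for x v
    using low[OF that, of "R x v"] R[OF that] by simp
  have "bdd_lipschitz_on N R"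
  proof (rule bdd_lipschitz_onI[of _ _ "1 / c" "L / c / c"])
    fix x assume x: "x \<in> N"
    show "norm (R x) \<le> 1 / c" using bd[OF x] c by (intro norm_blinfun_bound) auto
    fix y assume y: "y \<in> N"
    have nn: "0 \<le> L * dist x y" using L[OF x y] norm_ge_zero order_trans by blast
    show "norm (R x - R y) \<le> L / c / c * dist x y"
    proof (rule norm_blinfun_bound)
      fix v
      have "norm ((R x - R y) v) \<le> norm (S x ((R x - R y) v)) / c" by (rule low[OF x])
      also have "S x ((R x - R y) v) = (S y - S x) (R y v)"
        by (simp add: blinfun.diff_left blinfun.diff_right R x y)
      also have "norm \<dots> \<le> norm (S y - S x) * norm (R y v)" by (rule norm_blinfun)
      also have "\<dots> \<le> (L * dist x y) * (norm v / c)"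
        using L[OF x y] bd[OF y] nn by (intro mult_mono) (auto simp: norm_minus_commute)
      finally show "norm ((R x - R y) v) \<le> L / c / c * dist x y * norm v"
        using c by (simp add: divide_right_mono mult_ac)
    qed (use nn c in simp)
  qed
  then show ?thesis using R that by blast
qed

text \<open>Multiplication by a Lipschitz function of the distance to \<open>K\<close>. The cutoff is constantly 1 on a
  neighbourhood of \<open>K\<close>, and not only on \<open>K\<close>, so that solutions of the differential equation defined by
  the new map are solutions of the old one for as long as they stay close to \<open>K\<close>.\<close>

lemma bdd_lipschitz_on_cutoff:
  fixes F :: "'a::euclidean_space \<Rightarrow> 'b::real_normed_vector"
  assumes F: "bdd_lipschitz_on N F" and K: "compact K" "K \<subseteq> N" and N: "open N"
  obtains G N' where "bdd_lipschitz_on UNIV G" "open N'" "K \<subseteq> N'" "N' \<subseteq> N"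
    "\<And>x. x \<in> N' \<Longrightarrow> G x = F x"
proof (cases "K = {}")
  case True
  then show ?thesis by (intro that[of "\<lambda>_. 0" "{}"] bdd_lipschitz_on_const) auto
next
  case False
  obtain r where r: "r > 0" "(\<Union>x\<in>K. ball x r) \<subseteq> N"
    using compact_subset_open_imp_ball_epsilon_subset[OF K(1) N K(2)] by blast
  define A where "A = {x. infdist x K < r}"
  have AN: "A \<subseteq> N"
  proof
    fix x assume "x \<in> A"
    moreover obtain k where "k \<in> K" "infdist x K = dist x k"
      using infdist_attains_inf[OF compact_imp_closed[OF K(1)] False] by blast
    ultimately show "x \<in> N" using r by (force simp: A_def dist_commute)
  qed
  obtain M L where bnd: "M \<ge> 0" "L \<ge> 0" "\<And>x. x \<in> A \<Longrightarrow> norm (F x) \<le> M"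
    "\<And>x y. x \<in> A \<Longrightarrow> y \<in> A \<Longrightarrow> norm (F x - F y) \<le> L * dist x y"
    using bdd_lipschitz_on_subset[OF F AN] by (elim bdd_lipschitz_onE) blast
  \<comment> \<open>The value is 1 within distance \<open>r / 2\<close> of \<open>K\<close> and 0 from distance \<open>r\<close> on.\<close>
  define cut where "cut x = max 0 (min 1 (2 - 2 / r * infdist x K))" for x
  have cut01: "0 \<le> cut x" "cut x \<le> 1" for x by (auto simp: cut_def)
  have cutout: "cut x = 0" if "x \<notin> A" for x
    using that r by (auto simp: cut_def A_def field_simps)
  have cutlip: "\<bar>cut x - cut y\<bar> \<le> 2 / r * dist x y" for x y
  proof -
    have "\<bar>cut x - cut y\<bar> \<le> \<bar>(2 - 2 / r * infdist x K) - (2 - 2 / r * infdist y K)\<bar>"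
      by (auto simp: cut_def max_def min_def)
    also have "\<dots> = 2 / r * \<bar>infdist x K - infdist y K\<bar>"
    proof -
      have "(2 - 2 / r * infdist x K) - (2 - 2 / r * infdist y K) = - (2 / r * (infdist x K - infdist y K))"
        by (simp add: algebra_simps)
      then show ?thesis using r by (simp only: abs_minus_cancel abs_mult) simp
    qed
    also have "\<dots> \<le> 2 / r * dist x y" using infdist_triangle_abs r by (intro mult_left_mono) auto
    finally show ?thesis .
  qed
  define G where "G x = (if x \<in> A then cut x *\<^sub>R F x else 0)" for x
  have inout: "norm (G x - G y) \<le> (2 / r * M + L) * dist x y" if "x \<in> A" for x y
  proof (cases "y \<in> A")
    case True
    have "G x - G y = (cut x - cut y) *\<^sub>R F x + cut y *\<^sub>R (F x - F y)"
      using that True by (simp add: G_def algebra_simps)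
    then have "norm (G x - G y) \<le> \<bar>cut x - cut y\<bar> * norm (F x) + \<bar>cut y\<bar> * norm (F x - F y)"
      using norm_triangle_ineq[of "(cut x - cut y) *\<^sub>R F x" "cut y *\<^sub>R (F x - F y)"] by simp
    also have "\<dots> \<le> (2 / r * dist x y) * M + 1 * (L * dist x y)"
      using cutlip[of x y] bnd(3)[OF that] bnd(4)[OF that True] cut01[of y] r
      by (intro add_mono mult_mono) auto
    finally show ?thesis by (simp add: algebra_simps)
  next
    case False
    then have "norm (G x - G y) = \<bar>cut x - cut y\<bar> * norm (F x)"
      using that cutout[of y] by (simp add: G_def)
    also have "\<dots> \<le> (2 / r * dist x y) * M"
      using cutlip[of x y] bnd(3)[OF that] r by (intro mult_mono) auto
    also have "\<dots> \<le> (2 / r * M + L) * dist x y"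
      using bnd(2) mult_nonneg_nonneg[OF bnd(2), of "dist x y"] by (simp add: algebra_simps)
    finally show ?thesis .
  qed
  show ?thesis
  proof
    show "bdd_lipschitz_on UNIV G"
    proof (rule bdd_lipschitz_onI[of _ _ M "2 / r * M + L"])
      fix x
      show "norm (G x) \<le> M"
        using bnd(1) bnd(3)[of x] cut01[of x] mult_mono[of "cut x" 1 "norm (F x)" M] by (auto simp: G_def)
      fix y
      show "norm (G x - G y) \<le> (2 / r * M + L) * dist x y"
      proof (cases "x \<in> A \<or> y \<in> A")
        case True
        then show ?thesis
          using inout[of x y] inout[of y x] by (auto simp: norm_minus_commute dist_commute)
      next
        case False
        then show ?thesis using bnd r by (auto simp: G_def)
      qed
    qed
    show "open {x. infdist x K < r / 2}"
      by (intro open_Collect_less continuous_intros)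
    show "K \<subseteq> {x. infdist x K < r / 2}" using r by auto
    show "{x. infdist x K < r / 2} \<subseteq> N" using AN r by (force simp: A_def)
    fix x assume "x \<in> {x. infdist x K < r / 2}"
    then show "G x = F x" using r by (auto simp: G_def A_def cut_def field_simps)
  qed
qed


section \<open>Horizontal lifts tangent to the sphere\<close>

definition adjoint_blinfun :: "('a::euclidean_space \<Rightarrow>\<^sub>L 'b::euclidean_space) \<Rightarrow> 'b \<Rightarrow>\<^sub>L 'a" where
  "adjoint_blinfun A = Blinfun (adjoint (blinfun_apply A))"

lemma inner_adjoint_blinfun: "x \<bullet> adjoint_blinfun A y = A x \<bullet> y"
proof -
  have "bounded_linear (adjoint (blinfun_apply A))"
    using adjoint_linear[OF linear_blinfun_apply] by (simp add: linear_conv_bounded_linear)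
  then show ?thesis
    by (simp add: adjoint_blinfun_def bounded_linear_Blinfun_apply adjoint_works[OF linear_blinfun_apply])
qed

lemma bounded_linear_adjoint_blinfun: "bounded_linear adjoint_blinfun"
proof (rule bounded_linear_intro[of _ 1])
  fix A B :: "'a \<Rightarrow>\<^sub>L 'b" and r :: real
  show "adjoint_blinfun (A + B) = adjoint_blinfun A + adjoint_blinfun B"
    by (rule blinfun_eqI, rule vector_eq_ldot[THEN iffD1])
       (simp add: inner_adjoint_blinfun blinfun.add_left inner_add_left inner_add_right)
  show "adjoint_blinfun (r *\<^sub>R A) = r *\<^sub>R adjoint_blinfun A"
    by (rule blinfun_eqI, rule vector_eq_ldot[THEN iffD1])
       (simp add: inner_adjoint_blinfun blinfun.scaleR_left)
  show "norm (adjoint_blinfun A) \<le> norm A * 1"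
  proof (rule norm_blinfun_bound)
    fix y
    let ?z = "adjoint_blinfun A y"
    have "norm ?z * norm ?z = A ?z \<bullet> y"
      using inner_adjoint_blinfun[of ?z A y] by (simp flip: power2_norm_eq_inner add: power2_eq_square)
    also have "\<dots> \<le> (norm A * norm ?z) * norm y"
      by (rule order_trans[OF norm_cauchy_schwarz]) (intro mult_right_mono norm_blinfun norm_ge_zero)
    finally show "norm ?z \<le> norm A * 1 * norm y"
      by (cases "?z = 0") (auto simp: mult_ac)
  qed simp
qed

text \<open>The operator \<open>P = 1 - x x\<^sup>T / e\<^sup>2\<close> is positive definite inside the ball of radius \<open>e\<close>; on the
  sphere it becomes the orthogonal projection to the tangent space. So \<open>A P A\<^sup>T\<close> is positive definite as soon
  as \<open>A\<close> is surjective and, for \<open>x\<close> on the sphere, surjective on the tangent space.\<close>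

lemma positive_definite_lift_operator:
  fixes A :: "'a::euclidean_space \<Rightarrow>\<^sub>L 'b::euclidean_space"
  assumes e: "e > 0" and x: "norm x \<le> e" and surj: "surj (blinfun_apply A)"
    and bdry: "norm x = e \<Longrightarrow> blinfun_apply A ` {v. x \<bullet> v = 0} = UNIV"
    and v: "v \<noteq> 0"
  defines "u \<equiv> adjoint_blinfun A v"
  shows "u \<bullet> (u - (x \<bullet> u / e\<^sup>2) *\<^sub>R x) > 0"
proof -
  have Au: "A w \<bullet> v = w \<bullet> u" for w unfolding u_def by (simp add: inner_adjoint_blinfun)
  have u0: "u \<noteq> 0"
  proof
    assume "u = 0"
    moreover obtain w where "A w = v" using surj by (metis surjD)
    ultimately show False using Au[of w] v by simp
  qed
  have sq: "u \<bullet> (u - (x \<bullet> u / e\<^sup>2) *\<^sub>R x) = u \<bullet> u - (x \<bullet> u)\<^sup>2 / e\<^sup>2"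
    by (simp add: inner_diff_right power2_eq_square inner_commute)
  show ?thesis
  proof (cases "norm x = e")
    case True
    have xx: "x \<bullet> x = e\<^sup>2" using True by (simp add: dot_square_norm)
    let ?d = "u - (x \<bullet> u / e\<^sup>2) *\<^sub>R x"
    have "?d \<bullet> ?d = u \<bullet> ?d"
      using e xx by (simp add: inner_diff_left inner_diff_right inner_commute power2_eq_square)
    moreover have "?d \<noteq> 0"
    proof
      assume d: "?d = 0"
      obtain w where w: "A w = v" "x \<bullet> w = 0" 
        using bdry[OF True] by (metis (mono_tags, lifting) UNIV_I imageE mem_Collect_eq)
      have "w \<bullet> u = (x \<bullet> u / e\<^sup>2) * (w \<bullet> x)" using d by (metis eq_iff_diff_eq_0 inner_scaleR_right)
      then have "v \<bullet> v = 0" using Au[of w] w by (simp add: inner_commute)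
      then show False using v by simp
    qed
    ultimately show ?thesis by (metis inner_gt_zero_iff)
  next
    case False
    have "(x \<bullet> u)\<^sup>2 \<le> (norm x * norm u)\<^sup>2"
      using Cauchy_Schwarz_ineq2[of x u] by (metis abs_le_square_iff abs_mult abs_norm_cancel)
    also have "\<dots> < (e * norm u)\<^sup>2"
      using False x u0 e by (intro power_strict_mono mult_strict_right_mono) auto
    finally have "(x \<bullet> u)\<^sup>2 / e\<^sup>2 < (norm u)\<^sup>2"
      using e by (simp add: field_simps power_mult_distrib)
    then show ?thesis using sq by (simp add: power2_norm_eq_inner)
  qed
qed

text \<open>With \<open>P\<close> as above, \<open>W = P D\<^sup>T inverse (D P D\<^sup>T)\<close> lifts vectors of the base: \<open>D W = 1\<close>. Because of the factor
  \<open>P\<close>, the radial component of \<open>W\<close> vanishes to first order on the sphere. One formula therefore serves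
  for the interior and for the boundary. Cutoffs extend \<open>W\<close>, and \<open>\<phi>\<close> in the form of \<open>q\<close>, to the whole space,
  so that \<open>W x (v t (q x))\<close> defines a global vector field.\<close>

theorem horizontal_lift_near_compact:
  fixes \<phi> :: "'a::euclidean_space \<Rightarrow> 'b::euclidean_space" and D :: "'a \<Rightarrow> 'a \<Rightarrow>\<^sub>L 'b"
  assumes e: "e > 0"
    and der: "\<And>x. x \<in> ball 0 (2 * e) \<Longrightarrow> (\<phi> has_derivative blinfun_apply (D x)) (at x)"
    and Dlip: "bdd_lipschitz_on (ball 0 (2 * e)) D"
    and K: "compact K" "K \<subseteq> cball 0 e"
    and surj: "\<And>x. x \<in> K \<Longrightarrow> surj (blinfun_apply (D x))"
    and bdry: "\<And>x. x \<in> K \<Longrightarrow> norm x = e \<Longrightarrow> blinfun_apply (D x) ` {v. x \<bullet> v = 0} = UNIV"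
  obtains N W q M where "open N" "K \<subseteq> N" "N \<subseteq> ball 0 (2 * e)"
    "bdd_lipschitz_on UNIV W" "bdd_lipschitz_on UNIV q" "\<And>x. x \<in> N \<Longrightarrow> q x = \<phi> x"
    "\<And>x v. x \<in> N \<Longrightarrow> D x (blinfun_apply (W x) v) = v"
    "\<And>x v. x \<in> N \<Longrightarrow> \<bar>x \<bullet> W x v\<bar> \<le> M * \<bar>e\<^sup>2 - (norm x)\<^sup>2\<bar> * norm v"
proof -
  let ?B = "ball (0::'a) (2 * e)"
  define P :: "'a \<Rightarrow> 'a \<Rightarrow>\<^sub>L 'a" where
    "P x = id_blinfun - (1 / e\<^sup>2) *\<^sub>R (blinfun_scaleR_left x o\<^sub>L blinfun_inner_right x)" for x
  define S where "S x = D x o\<^sub>L (P x o\<^sub>L adjoint_blinfun (D x))" for x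
  have P: "P x u = u - (x \<bullet> u / e\<^sup>2) *\<^sub>R x" for x u
    by (simp add: P_def blinfun.diff_left blinfun.scaleR_left inner_commute)
  have idlip: "bdd_lipschitz_on ?B (\<lambda>x. x)"
    by (rule bdd_lipschitz_onI[of _ _ "2 * e" 1]) (auto simp: dist_norm)
  have Plip: "bdd_lipschitz_on ?B P"
    unfolding P_def
    by (intro bdd_lipschitz_on_diff bdd_lipschitz_on_const
        bdd_lipschitz_on_linear[OF bounded_linear_scaleR_right]
        bdd_lipschitz_on_bilinear[OF bounded_bilinear_blinfun_compose]
        bdd_lipschitz_on_linear[OF bounded_linear_blinfun_scaleR_left]
        bdd_lipschitz_on_linear[OF bounded_linear_blinfun_inner_right] idlip)
  have PAlip: "bdd_lipschitz_on ?B (\<lambda>x. P x o\<^sub>L adjoint_blinfun (D x))"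
    by (intro bdd_lipschitz_on_bilinear[OF bounded_bilinear_blinfun_compose] Plip
        bdd_lipschitz_on_linear[OF bounded_linear_adjoint_blinfun] Dlip)
  have Slip: "bdd_lipschitz_on ?B S"
    unfolding S_def by (intro bdd_lipschitz_on_bilinear[OF bounded_bilinear_blinfun_compose] Dlip PAlip)
  have KB: "K \<subseteq> ?B" using K(2) e by force
  have pos: "v \<bullet> S x v > 0" if "x \<in> K" "v \<noteq> 0" for x v
  proof -
    have "v \<bullet> S x v = adjoint_blinfun (D x) v \<bullet> P x (adjoint_blinfun (D x) v)"
      unfolding S_def by (simp add: inner_commute[of v] inner_commute[of _ "P x _"] inner_adjoint_blinfun)
    then show ?thesis
      using positive_definite_lift_operator[OF e _ surj[OF that(1)] bdry[OF that(1)] that(2)] K(2) that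
      by (auto simp: P)
  qed
  have "\<exists>c>0. \<forall>x\<in>K. \<forall>v\<in>sphere 0 1. 2 * c \<le> v \<bullet> S x v"
  proof (cases "K \<times> sphere (0::'b) 1 = {}")
    case True
    then show ?thesis by (intro exI[of _ 1]) auto
  next
    case False
    have "continuous_on (K \<times> sphere (0::'b) 1) (\<lambda>p. snd p \<bullet> S (fst p) (snd p))"
      by (intro continuous_intros continuous_on_compose2[OF bdd_lipschitz_on_continuous[OF Slip]])
         (use KB in auto)
    then obtain p where p: "p \<in> K \<times> sphere (0::'b) 1"
        "\<And>p'. p' \<in> K \<times> sphere (0::'b) 1 \<Longrightarrow> snd p \<bullet> S (fst p) (snd p) \<le> snd p' \<bullet> S (fst p') (snd p')"
      using continuous_attains_inf[OF compact_Times[OF K(1) compact_sphere] False] by blast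
    have "snd p \<bullet> S (fst p) (snd p) > 0" using p(1) by (intro pos) auto
    then show ?thesis
      using p(2) by (intro exI[of _ "(snd p \<bullet> S (fst p) (snd p)) / 2"]) (auto simp: mem_Times_iff)
  qed
  then obtain c where c: "c > 0" "\<And>x v. x \<in> K \<Longrightarrow> norm v = 1 \<Longrightarrow> 2 * c \<le> v \<bullet> S x v"
    by auto
  obtain M' L where L: "L \<ge> 0" "\<And>x y. x \<in> ?B \<Longrightarrow> y \<in> ?B \<Longrightarrow> norm (S x - S y) \<le> L * dist x y"
    using Slip by (elim bdd_lipschitz_onE) blast
  \<comment> \<open>On \<open>K\<close> the operators \<open>S x\<close> are coercive with constant \<open>2 * c\<close>; within distance \<open>r\<close>
    they change by at most \<open>c\<close>.\<close>
  define r where "r = min e (c / (L + 1))"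
  have r: "r > 0" "r \<le> e" "L * r \<le> c"
  proof -
    show "r > 0" "r \<le> e" using e c L by (auto simp: r_def)
    have "L * r \<le> (L + 1) * (c / (L + 1))" using L c e by (intro mult_mono) (auto simp: r_def)
    then show "L * r \<le> c" using L by simp
  qed
  define N where "N = (\<Union>k\<in>K. ball k r)"
  have NB: "N \<subseteq> ?B"
  proof
    fix x assume "x \<in> N"
    then obtain k where "k \<in> K" "dist k x < r" by (auto simp: N_def)
    then have "norm k \<le> e" "norm (k - x) < r" using K(2) by (auto simp: dist_norm)
    then show "x \<in> ?B" using r norm_triangle_ineq4[of k "k - x"] by simp
  qed
  have coercive: "c * (norm v)\<^sup>2 \<le> v \<bullet> S x v" if xN: "x \<in> N" for x v
  proof -
    obtain k where k: "k \<in> K" "dist k x < r" using xN by (auto simp: N_def)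
    have one: "c \<le> w \<bullet> S x w" if w: "norm w = 1" for w
    proof -
      have "\<bar>w \<bullet> (S x - S k) w\<bar> \<le> norm w * norm ((S x - S k) w)" by (rule Cauchy_Schwarz_ineq2)
      also have "\<dots> \<le> norm (S x - S k)" using norm_blinfun[of "S x - S k" w] w by simp
      also have "\<dots> \<le> L * dist x k" using L(2) NB \<open>x \<in> N\<close> k KB by blast
      also have "\<dots> \<le> L * r" using k L by (intro mult_left_mono) (auto simp: dist_commute)
      finally have "\<bar>w \<bullet> (S x - S k) w\<bar> \<le> c" using r by simp
      then show ?thesis using c(2)[OF k(1) w] by (simp add: blinfun.diff_left inner_diff_right)
    qed
    show ?thesis
    proof (cases "v = 0")
      case False
      have "c * (norm v)\<^sup>2 \<le> ((v /\<^sub>R norm v) \<bullet> S x (v /\<^sub>R norm v)) * (norm v)\<^sup>2"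
        using one[of "v /\<^sub>R norm v"] False by (intro mult_right_mono) auto
      also have "\<dots> = v \<bullet> S x v"
        using False by (simp add: blinfun.scaleR_right power2_eq_square field_simps)
      finally show ?thesis .
    qed simp
  qed
  obtain R where R: "bdd_lipschitz_on N R" "\<And>x v. x \<in> N \<Longrightarrow> S x (blinfun_apply (R x) v) = v"
    using bdd_lipschitz_on_inverse[OF bdd_lipschitz_on_subset[OF Slip NB] c(1) coercive] by blast
  define W where "W x = (P x o\<^sub>L adjoint_blinfun (D x)) o\<^sub>L R x" for x
  have Wlip: "bdd_lipschitz_on N W"
    unfolding W_def
    by (intro bdd_lipschitz_on_bilinear[OF bounded_bilinear_blinfun_compose] R
        bdd_lipschitz_on_subset[OF PAlip NB])
  have "bdd_lipschitz_on N (\<lambda>x. adjoint_blinfun (D x) o\<^sub>L R x)"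
    by (intro bdd_lipschitz_on_bilinear[OF bounded_bilinear_blinfun_compose] R
        bdd_lipschitz_on_linear[OF bounded_linear_adjoint_blinfun] bdd_lipschitz_on_subset[OF Dlip NB])
  then obtain m where m: "m \<ge> 0" "\<And>x. x \<in> N \<Longrightarrow> norm (adjoint_blinfun (D x) o\<^sub>L R x) \<le> m"
    by (elim bdd_lipschitz_onE) blast
  have DW: "D x (W x v) = v" if "x \<in> N" for x v
    using R(2)[OF that, of v] by (simp add: W_def S_def)
  have xW: "\<bar>x \<bullet> W x v\<bar> \<le> (2 * m / e) * \<bar>e\<^sup>2 - (norm x)\<^sup>2\<bar> * norm v" if "x \<in> N" for x v
  proof -
    let ?z = "(adjoint_blinfun (D x) o\<^sub>L R x) v"
    have "x \<bullet> W x v = (x \<bullet> ?z) * ((e\<^sup>2 - (norm x)\<^sup>2) / e\<^sup>2)"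
      using e by (simp add: W_def P inner_diff_right power2_norm_eq_inner field_simps)
    then have "\<bar>x \<bullet> W x v\<bar> = \<bar>x \<bullet> ?z\<bar> * (\<bar>e\<^sup>2 - (norm x)\<^sup>2\<bar> / e\<^sup>2)"
      by (simp add: abs_mult)
    also have "\<bar>x \<bullet> ?z\<bar> \<le> norm x * norm ?z" by (rule Cauchy_Schwarz_ineq2)
    also have "\<dots> \<le> (2 * e) * (m * norm v)"
    proof (intro mult_mono)
      show "norm x \<le> 2 * e" using NB that by force
      show "norm ?z \<le> m * norm v"
        by (rule order_trans[OF norm_blinfun]) (intro mult_right_mono m(2)[OF that] norm_ge_zero)
    qed (use e m in auto)
    finally show ?thesis using e by (simp add: mult_right_mono power2_eq_square field_simps)
  qed
  have \<phi>lip: "bdd_lipschitz_on ?B \<phi>"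
  proof -
    obtain M where M: "M \<ge> 0" "\<And>x. x \<in> ?B \<Longrightarrow> norm (D x) \<le> M"
      using Dlip by (elim bdd_lipschitz_onE) blast
    have lip: "norm (\<phi> x - \<phi> y) \<le> M * dist x y" if "x \<in> ?B" "y \<in> ?B" for x y
      unfolding dist_norm
    proof (rule differentiable_bound[OF convex_ball _ _ that])
      show "(\<phi> has_derivative blinfun_apply (D x)) (at x within ?B)" if "x \<in> ?B" for x
        by (rule has_derivative_at_withinI[OF der[OF that]])
      show "onorm (blinfun_apply (D x)) \<le> M" if "x \<in> ?B" for x
        using M(2)[OF that] by (simp add: norm_blinfun.rep_eq)
    qed
    have "norm (\<phi> x) \<le> norm (\<phi> 0) + M * (2 * e)" if "x \<in> ?B" for x
    proof -
      have "M * dist x 0 \<le> M * (2 * e)" using that M(1) by (intro mult_left_mono) auto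
      then show ?thesis
        using lip[OF that, of 0] e norm_triangle_ineq2[of "\<phi> x" "\<phi> 0"] by simp
    qed
    then show ?thesis using lip by (rule bdd_lipschitz_onI)
  qed
  have oN: "open N" and KN: "K \<subseteq> N" using r(1) by (auto simp: N_def)
  obtain W' N1 where W': "bdd_lipschitz_on UNIV W'" "open N1" "K \<subseteq> N1" "N1 \<subseteq> N" "\<And>x. x \<in> N1 \<Longrightarrow> W' x = W x"
    using bdd_lipschitz_on_cutoff[OF Wlip K(1) KN oN] by blast
  obtain q N2 where q: "bdd_lipschitz_on UNIV q" "open N2" "K \<subseteq> N2" "N2 \<subseteq> ?B" "\<And>x. x \<in> N2 \<Longrightarrow> q x = \<phi> x"
    using bdd_lipschitz_on_cutoff[OF \<phi>lip K(1) KB open_ball] by blast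
  show ?thesis
    by (rule that[of "N1 \<inter> N2" W' q "2 * m / e"]) (use W' q NB DW xW in auto)
qed


section \<open>Parallel transport\<close>

text \<open>Solving backwards from a prescribed end point; this will show that the flow maps onto the
  fibres.\<close>

lemma solution_through:
  fixes f :: "real \<Rightarrow> 'a::euclidean_space \<Rightarrow> 'a"
  assumes cont: "\<And>x. continuous_on {0..1} (\<lambda>t. f t x)"
    and lip: "\<And>t x y. t \<in> {0..1} \<Longrightarrow> norm (f t x - f t y) \<le> L * norm (x - y)"
    and L: "L \<ge> 0" and t: "t \<in> {0..1}"
  obtains x where "x t = z" "solves_ode f 0 t x"
proof -
  have cont': "continuous_on {0..t} (\<lambda>s. - f (t - s) x)" for x
    using t by (intro continuous_intros continuous_on_compose2[OF cont]) auto
  have lip': "norm (- f (t - s) x - - f (t - s) y) \<le> L * norm (x - y)" if "s \<in> {0..t}" for s x y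
    using lip[of "t - s" y x] that t by (simp add: norm_minus_commute)
  obtain y where y: "y 0 = z" "solves_ode (\<lambda>s x. - f (t - s) x) 0 t y"
    by (rule global_Picard_Lindeloef[OF cont' lip' L])
  have img: "(\<lambda>s. t - s) ` {0..t} = {0..t}"
    by (auto simp: image_iff intro!: bexI[of _ "t - _"])
  have "solves_ode f 0 t (\<lambda>s. y (t - s))"
    unfolding solves_ode_def
  proof
    fix s assume s: "s \<in> {0..t}"
    have "((\<lambda>s. t - s) has_vector_derivative (0 - 1)) (at s within {0..t})"
      by (intro has_vector_derivative_diff has_vector_derivative_const has_vector_derivative_id)
    moreover have "(y has_vector_derivative - f (t - (t - s)) (y (t - s))) (at (t - s) within (\<lambda>s. t - s) ` {0..t})"
      unfolding img by (rule solves_odeD[OF y(2)]) (use s in auto)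
    ultimately have "(y \<circ> (\<lambda>s. t - s) has_vector_derivative (0 - 1) *\<^sub>R - f (t - (t - s)) (y (t - s))) (at s within {0..t})"
      by (rule vector_diff_chain_within)
    then show "((\<lambda>s. y (t - s)) has_vector_derivative f s (y (t - s))) (at s within {0..t})"
      by (simp add: o_def)
  qed
  then show ?thesis using that[of "\<lambda>s. y (t - s)"] y(1) by simp
qed

text \<open>If \<open>\<rho>\<close> changed its sign it would have a zero, and the growth bound for \<open>\<rho>\<^sup>2\<close>, applied from that
  zero in both directions, would make \<open>\<rho>\<close> vanish identically. This keeps lifted curves inside the closed
  ball, with \<open>\<rho> = e\<^sup>2 - \<bar>x\<bar>\<^sup>2\<close>.\<close>

lemma nonnegative_persists:
  fixes \<rho> \<rho>' :: "real \<Rightarrow> real"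
  assumes der: "\<And>t. t \<in> {a..b} \<Longrightarrow> (\<rho> has_real_derivative \<rho>' t) (at t within {a..b})"
    and bound: "\<And>t. t \<in> {a..b} \<Longrightarrow> \<bar>\<rho>' t\<bar> \<le> K * \<bar>\<rho> t\<bar>"
    and t: "t \<in> {a..b}" "\<rho> t \<ge> 0" and s: "s \<in> {a..b}"
  shows "\<rho> s \<ge> 0"
proof (rule ccontr)
  assume neg: "\<not> \<rho> s \<ge> 0"
  have "connected (\<rho> ` {a..b})"
    by (intro connected_continuous_image DERIV_continuous_on[OF der] connected_Icc)
  then have "{\<rho> s..\<rho> t} \<subseteq> \<rho> ` {a..b}" using s t by (intro connected_contains_Icc) auto
  then have "0 \<in> \<rho> ` {a..b}" using t neg by auto
  then obtain z where z: "z \<in> {a..b}" "\<rho> z = 0" by force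
  have der2: "((\<lambda>t. (\<rho> t)\<^sup>2) has_real_derivative 2 * (\<rho> r * \<rho>' r)) (at r within {a..b})"
    if "r \<in> {a..b}" for r
    using der[OF that] by (auto intro!: derivative_eq_intros)
  have bound2: "\<bar>2 * (\<rho> r * \<rho>' r)\<bar> \<le> (2 * K) * (\<rho> r)\<^sup>2" if "r \<in> {a..b}" for r
  proof -
    have "\<bar>\<rho> r\<bar> * \<bar>\<rho>' r\<bar> \<le> \<bar>\<rho> r\<bar> * (K * \<bar>\<rho> r\<bar>)" using bound[OF that] by (intro mult_left_mono) auto
    also have "\<dots> = K * (\<bar>\<rho> r\<bar> * \<bar>\<rho> r\<bar>)" by (simp only: mult_ac)
    also have "\<bar>\<rho> r\<bar> * \<bar>\<rho> r\<bar> = (\<rho> r)\<^sup>2" by (simp add: power2_eq_square)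
    finally show ?thesis by (simp add: abs_mult)
  qed
  have "(\<rho> s)\<^sup>2 \<le> 0"
  proof (cases "z \<le> s")
    case True
    then show ?thesis using growth_bound_two_sided(1)[OF der2 bound2, of z s] z s by simp
  next
    case False
    then show ?thesis using growth_bound_two_sided(2)[OF der2 bound2, of s z] z s by simp
  qed
  then show False using neg by simp
qed

text \<open>A form of Ehresmann's theorem for the closed ball as a manifold with boundary. The base field \<open>v\<close>
  is lifted with \<open>W\<close>. Where the lift is valid, \<open>\<phi>\<close> of a lifted curve solves the same equation as the base
  curve \<open>c\<close>, hence agrees with it, and the curve cannot leave the ball. The times at which the curve lies in
  the ball over \<open>c\<close> thus form an open and closed set. A single flow serves all integral curves \<open>c\<close> of \<open>v\<close>
  in \<open>C\<close>; this is what makes the circles through the points of a path move together continuously.\<close>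

theorem parallel_transport:
  fixes \<phi> :: "'a::euclidean_space \<Rightarrow> 'b::euclidean_space" and D :: "'a \<Rightarrow> 'a \<Rightarrow>\<^sub>L 'b"
    and v :: "real \<Rightarrow> 'b \<Rightarrow> 'b"
  assumes e: "e > 0"
    and der: "\<And>x. x \<in> ball 0 (2 * e) \<Longrightarrow> (\<phi> has_derivative blinfun_apply (D x)) (at x)"
    and Dlip: "bdd_lipschitz_on (ball 0 (2 * e)) D"
    and C: "compact C"
    and surj: "\<And>x. norm x \<le> e \<Longrightarrow> \<phi> x \<in> C \<Longrightarrow> surj (blinfun_apply (D x))"
    and bdry: "\<And>x. norm x = e \<Longrightarrow> \<phi> x \<in> C \<Longrightarrow> blinfun_apply (D x) ` {v. x \<bullet> v = 0} = UNIV"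
    and vcont: "\<And>y. continuous_on {0..1} (\<lambda>t. v t y)"
    and vlip: "\<And>t y z. t \<in> {0..1} \<Longrightarrow> norm (v t y - v t z) \<le> Lv * norm (y - z)"
  obtains X where "continuous_on ({0..1} \<times> UNIV) (\<lambda>(t, x). X t x)" "\<And>x. X 0 x = x"
    "\<And>c t. solves_ode v 0 1 c \<Longrightarrow> c ` {0..1} \<subseteq> C \<Longrightarrow> t \<in> {0..1} \<Longrightarrow>
       bij_betw (X t) {x \<in> cball 0 e. \<phi> x = c 0} {x \<in> cball 0 e. \<phi> x = c t}"
proof -
  define K where "K = {x \<in> cball 0 e. \<phi> x \<in> C}"
  have \<phi>cont: "continuous_on (ball 0 (2 * e)) \<phi>"
    by (intro continuous_at_imp_continuous_on ballI has_derivative_continuous[OF der])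
  have \<phi>cont': "continuous_on (cball 0 e) \<phi>"
    by (rule continuous_on_subset[OF \<phi>cont]) (use e in auto)
  have cK: "compact K"
  proof -
    have "closed (cball 0 e \<inter> \<phi> -` C)"
      by (rule continuous_closed_preimage[OF \<phi>cont' closed_cball compact_imp_closed[OF C]])
    moreover have "K = cball 0 e \<inter> \<phi> -` C" by (auto simp: K_def)
    moreover have "bounded K" by (rule bounded_subset[OF bounded_cball[of 0 e]]) (auto simp: K_def)
    ultimately show ?thesis by (simp add: compact_eq_bounded_closed)
  qed
  have Ke: "K \<subseteq> cball 0 e" by (auto simp: K_def)
  have sK: "surj (blinfun_apply (D x))" if "x \<in> K" for x using that surj by (auto simp: K_def)
  have bK: "blinfun_apply (D x) ` {v. x \<bullet> v = 0} = UNIV" if "x \<in> K" "norm x = e" for x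
    using that bdry by (auto simp: K_def)
  obtain N W q M where N: "open N" "K \<subseteq> N" "N \<subseteq> ball 0 (2 * e)"
    and W: "bdd_lipschitz_on UNIV W" and q: "bdd_lipschitz_on UNIV q"
    and q\<phi>: "\<And>x. x \<in> N \<Longrightarrow> q x = \<phi> x"
    and DW: "\<And>x v. x \<in> N \<Longrightarrow> D x (blinfun_apply (W x) v) = v"
    and xW: "\<And>x v. x \<in> N \<Longrightarrow> \<bar>x \<bullet> W x v\<bar> \<le> M * \<bar>e\<^sup>2 - (norm x)\<^sup>2\<bar> * norm v"
    using horizontal_lift_near_compact[OF e der Dlip cK Ke sK bK] by blast
  obtain MW LW where WB: "MW \<ge> 0" "LW \<ge> 0" "\<And>x. norm (W x) \<le> MW"
    "\<And>x y. norm (W x - W y) \<le> LW * dist x y"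
    using W by (elim bdd_lipschitz_onE) blast
  obtain Mq Lq where qB: "Mq \<ge> 0" "Lq \<ge> 0" "\<And>x. norm (q x) \<le> Mq"
    "\<And>x y. norm (q x - q y) \<le> Lq * dist x y"
    using q by (elim bdd_lipschitz_onE) blast
  have Lv: "Lv \<ge> 0"
  proof -
    obtain b :: 'b where "b \<in> Basis" using nonempty_Basis by blast
    then show ?thesis using vlip[of 0 b 0] order_trans[OF norm_ge_zero vlip[of 0 b 0]] by simp
  qed
  obtain M0 where M0: "\<And>t. t \<in> {0..1} \<Longrightarrow> norm (v t 0) \<le> M0"
    using compact_imp_bounded[OF compact_continuous_image[OF vcont[of 0] compact_Icc]]
    unfolding bounded_iff by blast
  define Mv where "Mv = M0 + Lv * Mq"
  have vq: "norm (v t (q x)) \<le> Mv" if "t \<in> {0..1}" for t x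
  proof -
    have "norm (v t (q x)) \<le> norm (v t 0) + norm (v t (q x) - v t 0)"
      using norm_triangle_ineq[of "v t 0" "v t (q x) - v t 0"] by simp
    also have "\<dots> \<le> M0 + Lv * norm (q x - 0)" using M0[OF that] vlip[OF that] by (intro add_mono)
    also have "\<dots> \<le> Mv" using qB(3)[of x] Lv by (auto simp: Mv_def intro: mult_left_mono)
    finally show ?thesis .
  qed
  have Mv: "Mv \<ge> 0" using order_trans[OF norm_ge_zero vq[of 0]] by simp

  define f where "f t x = W x (v t (q x))" for t x
  define L where "L = LW * Mv + MW * (Lv * Lq)"
  have L: "L \<ge> 0" using WB qB Lv Mv by (simp add: L_def)
  have fcont: "continuous_on {0..1} (\<lambda>t. f t x)" for x
    unfolding f_def by (intro continuous_intros vcont)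
  have flip: "norm (f t x - f t y) \<le> L * norm (x - y)" if t: "t \<in> {0..1}" for t x y
  proof -
    have "f t x - f t y = (W x - W y) (v t (q x)) + W y (v t (q x) - v t (q y))"
      by (simp add: f_def blinfun.diff_left blinfun.diff_right)
    also have "norm \<dots> \<le> norm (W x - W y) * norm (v t (q x)) + norm (W y) * norm (v t (q x) - v t (q y))"
      by (rule order_trans[OF norm_triangle_ineq add_mono[OF norm_blinfun norm_blinfun]])
    also have "\<dots> \<le> (LW * dist x y) * Mv + MW * (Lv * (Lq * dist x y))"
    proof (intro add_mono mult_mono)
      show "norm (v t (q x) - v t (q y)) \<le> Lv * (Lq * dist x y)"
        using vlip[OF t] by (rule order_trans) (intro mult_left_mono qB Lv)
    qed (use WB qB Lv Mv vq[OF t] in auto)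
    finally show ?thesis by (simp add: L_def dist_norm algebra_simps)
  qed
  have "\<exists>x. x 0 = x0 \<and> solves_ode f 0 1 x" for x0
    using global_Picard_Lindeloef[OF fcont flip L] by metis
  then obtain sol where sol: "\<And>x0. sol x0 0 = x0" "\<And>x0. solves_ode f 0 1 (sol x0)" by metis
  define X where "X t x = sol x t" for t x
  have grow: "(norm (X t x - X t y))\<^sup>2 \<le> (norm (x - y))\<^sup>2 * exp (2 * L)" if "t \<in> {0..1}" for t x y
  proof -
    have "(norm (X t x - X t y))\<^sup>2 \<le> (norm (x - y))\<^sup>2 * exp (2 * L * (t - 0))"
      using solves_ode_growth(1)[OF sol(2) sol(2) flip, of 0 t x y] that by (simp add: X_def sol)
    also have "\<dots> \<le> (norm (x - y))\<^sup>2 * exp (2 * L)"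
      using that L by (intro mult_left_mono) (auto intro: mult_left_le)
    finally show ?thesis .
  qed
  have Xlip: "(exp L)-lipschitz_on UNIV (X t)" if "t \<in> {0..1}" for t
  proof (rule lipschitz_onI)
    fix x y
    have "(norm (X t x - X t y))\<^sup>2 \<le> (exp L * norm (x - y))\<^sup>2"
      using grow[OF that, of x y] by (simp add: power_mult_distrib exp_double[symmetric] mult.commute[of _ "exp (2 * L)"])
    then show "dist (X t x) (X t y) \<le> exp L * dist x y"
      unfolding dist_norm by (rule power2_le_imp_le) simp
  qed simp
  have Xcont: "continuous_on ({0..1} \<times> UNIV) (\<lambda>(t, x). X t x)"
  proof (rule continuous_on_TimesI)
    show "local_lipschitz {0..1} UNIV X"
    proof (rule local_lipschitzI)
      fix t :: real and x :: 'a
      show "\<exists>u>0. \<exists>L. \<forall>t\<in>cball t u \<inter> {0..1}. L-lipschitz_on (cball x u \<inter> UNIV) (X t)"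
        by (intro exI[of _ 1] conjI exI[of _ "exp L"] ballI lipschitz_on_subset[OF Xlip]) auto
    qed
    show "continuous_on {0..1} (\<lambda>t. X t x)" for x
      unfolding X_def by (rule solves_ode_continuous_on[OF sol(2)])
  qed

  have invariant: "\<forall>t\<in>{0..1}. x t \<in> cball 0 e \<and> \<phi> (x t) = c t"
    if x: "solves_ode f 0 1 x" and c: "solves_ode v 0 1 c" "c ` {0..1} \<subseteq> C"
      and t1: "t1 \<in> {0..1}" "x t1 \<in> cball 0 e" "\<phi> (x t1) = c t1" for x c t1
  proof -
    let ?G = "{t \<in> {0..1}. x t \<in> cball 0 e \<and> \<phi> (x t) = c t}"
    have xc: "continuous_on {0..1} x" by (rule solves_ode_continuous_on[OF x])
    have cc: "continuous_on {0..1} c" by (rule solves_ode_continuous_on[OF c(1)])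
    have "closed ?G"
    proof -
      have cl: "closed ({0..1} \<inter> x -` cball 0 e)"
        by (rule continuous_closed_preimage[OF xc]) auto
      have "continuous_on ({0..1} \<inter> x -` cball 0 e) (\<lambda>t. \<phi> (x t) - c t)"
        by (intro continuous_intros continuous_on_compose2[OF \<phi>cont'] continuous_on_subset[OF xc]
            continuous_on_subset[OF cc]) auto
      then have "closed (({0..1} \<inter> x -` cball 0 e) \<inter> (\<lambda>t. \<phi> (x t) - c t) -` {0})"
        by (rule continuous_closed_preimage[OF _ cl]) auto
      also have "({0..1} \<inter> x -` cball 0 e) \<inter> (\<lambda>t. \<phi> (x t) - c t) -` {0} = ?G" by auto
      finally show ?thesis .
    qed
    then have closed: "closedin (top_of_set {0..1}) ?G" by (intro closed_subset) auto
    \<comment> \<open>On an interval \<open>{a..b}\<close> around \<open>t\<close> the curve stays where \<open>W\<close> is a lift and \<open>q\<close> equals \<open>\<phi>\<close>.\<close>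
    have "openin (top_of_set {0..1}) ?G"
      unfolding openin_euclidean_subtopology_iff
    proof (intro conjI ballI)
      fix t assume tG: "t \<in> ?G"
      then have t: "t \<in> {0..1}" and xt: "x t \<in> cball 0 e" "\<phi> (x t) = c t" by auto
      have "x t \<in> K" using tG c(2) by (auto simp: K_def)
      then have "x t \<in> N" using N by blast
      then obtain r where r: "r > 0" "ball (x t) r \<subseteq> N" using N(1) open_contains_ball by blast
      obtain d where d: "d > 0" "\<And>s. s \<in> {0..1} \<Longrightarrow> dist s t < d \<Longrightarrow> dist (x s) (x t) < r"
        using xc t r(1) unfolding continuous_on_iff by meson
      define a b where "a = max 0 (t - d / 2)" and "b = min 1 (t + d / 2)"
      have ab: "0 \<le> a" "b \<le> 1" "t \<in> {a..b}" using t d by (auto simp: a_def b_def)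
      have xN: "x s \<in> N" if "s \<in> {a..b}" for s
      proof -
        have "s \<in> {0..1}" "dist s t < d" using that ab d by (auto simp: a_def b_def dist_real_def)
        from d(2)[OF this] show ?thesis using r by (auto simp: dist_commute)
      qed
      have xab: "solves_ode f a b x" and cab: "solves_ode v a b c"
        using solves_ode_subinterval x c ab by blast+
      have "solves_ode v a b (\<lambda>s. \<phi> (x s))"
        unfolding solves_ode_def
      proof
        fix s assume s: "s \<in> {a..b}"
        have "x s \<in> ball 0 (2 * e)" using xN[OF s] N by blast
        have "((\<phi> \<circ> x) has_derivative (blinfun_apply (D (x s)) \<circ> (\<lambda>h. h *\<^sub>R f s (x s)))) (at s within {a..b})"
          using solves_odeD[OF xab s, unfolded has_vector_derivative_def]
            has_derivative_at_withinI[OF der[OF \<open>x s \<in> ball 0 (2 * e)\<close>]] by (rule diff_chain_within)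
        moreover have "D (x s) (f s (x s)) = v s (\<phi> (x s))"
          using DW[OF xN[OF s]] q\<phi>[OF xN[OF s]] by (simp add: f_def)
        ultimately show "((\<lambda>s. \<phi> (x s)) has_vector_derivative v s (\<phi> (x s))) (at s within {a..b})"
          by (simp add: has_vector_derivative_def o_def blinfun.scaleR_right)
      qed
      then have \<phi>x: "\<phi> (x s) = c s" if "s \<in> {a..b}" for s
        by (rule solves_ode_unique[OF _ cab, of _ Lv t]) (use vlip ab xt that in auto)
      have nonneg: "e\<^sup>2 - (norm (x s))\<^sup>2 \<ge> 0" if "s \<in> {a..b}" for s
      proof (rule nonnegative_persists[OF _ _ ab(3) _ that])
        fix s assume s: "s \<in> {a..b}"
        show "((\<lambda>s. e\<^sup>2 - (norm (x s))\<^sup>2) has_real_derivative 0 - 2 * (x s \<bullet> f s (x s))) (at s within {a..b})"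
          by (intro DERIV_diff DERIV_const has_real_derivative_norm_square solves_odeD[OF xab s])
        have "\<bar>x s \<bullet> f s (x s)\<bar> \<le> M * \<bar>e\<^sup>2 - (norm (x s))\<^sup>2\<bar> * norm (v s (q (x s)))"
          unfolding f_def by (rule xW[OF xN[OF s]])
        also have "\<dots> \<le> \<bar>M\<bar> * \<bar>e\<^sup>2 - (norm (x s))\<^sup>2\<bar> * Mv"
          using vq[of s "x s"] s ab by (intro mult_mono) (auto intro: mult_right_mono)
        finally show "\<bar>0 - 2 * (x s \<bullet> f s (x s))\<bar> \<le> (2 * \<bar>M\<bar> * Mv) * \<bar>e\<^sup>2 - (norm (x s))\<^sup>2\<bar>"
          by (simp add: abs_mult mult_ac)
      next
        show "e\<^sup>2 - (norm (x t))\<^sup>2 \<ge> 0" using xt e by (simp add: power_mono)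
      qed
      show "\<exists>ea>0. \<forall>s\<in>{0..1}. dist s t < ea \<longrightarrow> s \<in> ?G"
      proof (intro exI[of _ "d / 2"] conjI ballI impI)
        fix s assume "s \<in> {0..1}" and "dist s t < d / 2"
        then have "t - d / 2 \<le> s" "s \<le> t + d / 2" unfolding dist_real_def by linarith+
        then have s: "s \<in> {a..b}" using \<open>s \<in> {0..1}\<close> by (auto simp: a_def b_def)
        have "norm (x s) \<le> e" using nonneg[OF s] e by (intro power2_le_imp_le[of "norm (x s)" e]) auto
        then show "s \<in> ?G" using \<phi>x[OF s] \<open>s \<in> {0..1}\<close> by simp
      qed (use d in simp)
    qed auto
    with closed have "?G = {} \<or> ?G = {0..1}"
      using connected_Icc[of 0 "1::real"] unfolding connected_clopen by blast
    then show ?thesis using t1 by auto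
  qed

  show ?thesis
  proof (rule that[OF Xcont])
    show "X 0 x = x" for x by (simp add: X_def sol)
    fix c t assume c: "solves_ode v 0 1 c" "c ` {0..1} \<subseteq> C" and t: "t \<in> {0..1::real}"
    show "bij_betw (X t) {x \<in> cball 0 e. \<phi> x = c 0} {x \<in> cball 0 e. \<phi> x = c t}"
      unfolding bij_betw_def
    proof
      show "inj_on (X t) {x \<in> cball 0 e. \<phi> x = c 0}"
      proof (rule inj_onI)
        fix x y assume "X t x = X t y"
        then have "(norm (x - y))\<^sup>2 \<le> 0"
          using solves_ode_growth(2)[OF sol(2) sol(2) flip, of 0 t x y] t by (simp add: X_def sol)
        then show "x = y" by simp
      qed
      show "X t ` {x \<in> cball 0 e. \<phi> x = c 0} = {x \<in> cball 0 e. \<phi> x = c t}"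
      proof (intro equalityI subsetI)
        fix z assume "z \<in> X t ` {x \<in> cball 0 e. \<phi> x = c 0}"
        then obtain x where x: "z = X t x" "x \<in> cball 0 e" "\<phi> x = c 0" by auto
        have "\<forall>t\<in>{0..1}. sol x t \<in> cball 0 e \<and> \<phi> (sol x t) = c t"
          by (rule invariant[OF sol(2) c, of 0]) (use x in \<open>auto simp: sol\<close>)
        then show "z \<in> {x \<in> cball 0 e. \<phi> x = c t}" using t x by (auto simp: X_def)
      next
        fix z assume z: "z \<in> {x \<in> cball 0 e. \<phi> x = c t}"
        obtain x where x: "x t = z" "solves_ode f 0 t x"
          by (rule solution_through[OF fcont flip L t])
        have "sol (x 0) t = x t"
          by (rule solves_ode_unique[OF solves_ode_subinterval[OF sol(2)] x(2), where L = L and s = 0])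
             (use t flip in \<open>auto simp: sol\<close>)
        then have zt: "sol (x 0) t = z" using x by simp
        have "\<forall>s\<in>{0..1}. sol (x 0) s \<in> cball 0 e \<and> \<phi> (sol (x 0) s) = c s"
          by (rule invariant[OF sol(2) c t]) (use z zt in auto)
        then have "x 0 \<in> cball 0 e \<and> \<phi> (x 0) = c 0"
          using sol(1)[of "x 0"] by (metis atLeastAtMost_iff order_refl zero_le_one)
        then show "z \<in> X t ` {x \<in> cball 0 e. \<phi> x = c 0}"
          using zt by (auto simp: X_def intro!: image_eqI[of _ _ "x 0"])
      qed
    qed
  qed
qed


section \<open>Transport in homology\<close>

lemma path_trivialisationE:
  assumes triv: "path_trivialisation \<phi> \<epsilon> \<gamma> \<Psi>"
  obtains G where "continuous_on ({0..1} \<times> fibre \<phi> \<epsilon> (\<gamma> 0)) (\<lambda>(t, x). \<Psi> t x)"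
    "\<And>t x. t \<in> {0..1} \<Longrightarrow> x \<in> fibre \<phi> \<epsilon> (\<gamma> 0) \<Longrightarrow> \<Psi> t x \<in> fibre \<phi> \<epsilon> (\<gamma> t)"
    "\<And>x. x \<in> fibre \<phi> \<epsilon> (\<gamma> 0) \<Longrightarrow> \<Psi> 0 x = x"
    "continuous_on {(t, z). t \<in> {0..1} \<and> z \<in> fibre \<phi> \<epsilon> (\<gamma> t)} (\<lambda>(t, z). G t z)"
    "\<And>t z. t \<in> {0..1} \<Longrightarrow> z \<in> fibre \<phi> \<epsilon> (\<gamma> t) \<Longrightarrow> G t z \<in> fibre \<phi> \<epsilon> (\<gamma> 0)"
    "\<And>t x. t \<in> {0..1} \<Longrightarrow> x \<in> fibre \<phi> \<epsilon> (\<gamma> 0) \<Longrightarrow> G t (\<Psi> t x) = x"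
    "\<And>t z. t \<in> {0..1} \<Longrightarrow> z \<in> fibre \<phi> \<epsilon> (\<gamma> t) \<Longrightarrow> \<Psi> t (G t z) = z"
proof -
  let ?F = "\<lambda>t. fibre \<phi> \<epsilon> (\<gamma> t)"
  let ?E = "{(x, t). t \<in> {0..1} \<and> x \<in> ?F t}"
  let ?T = "\<lambda>(x, t). (\<Psi> t x, t)"
  obtain g where g: "homeomorphic_maps (top_of_set (?F 0 \<times> {0..1})) (top_of_set ?E) ?T g"
    using triv unfolding path_trivialisation_def homeomorphic_map_maps by blast
  note g' = g[unfolded homeomorphic_maps_def continuous_map_in_subtopology continuous_map_iff_continuous
      topspace_euclidean_subtopology]
  note T = g'[THEN conjunct1, THEN conjunct1] g'[THEN conjunct1, THEN conjunct2]
  note gc = g'[THEN conjunct2, THEN conjunct1, THEN conjunct1] g'[THEN conjunct2, THEN conjunct1, THEN conjunct2]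
  note gT = g'[THEN conjunct2, THEN conjunct2, THEN conjunct1, THEN bspec]
  note Tg = g'[THEN conjunct2, THEN conjunct2, THEN conjunct2, THEN bspec]
  show ?thesis
  proof (rule that[of "\<lambda>t z. fst (g (z, t))"])
    have "continuous_on ({0..1} \<times> ?F 0) (\<lambda>p. fst (?T (snd p, fst p)))"
      by (intro continuous_on_compose2[OF T(1)] continuous_intros) auto
    then show "continuous_on ({0..1} \<times> ?F 0) (\<lambda>(t, x). \<Psi> t x)" by (simp add: case_prod_beta)
    have "continuous_on {(t, z). t \<in> {0..1} \<and> z \<in> ?F t} (\<lambda>p. fst (g (snd p, fst p)))"
      by (intro continuous_on_fst continuous_on_compose2[OF gc(1)] continuous_intros) auto
    then show "continuous_on {(t, z). t \<in> {0..1} \<and> z \<in> ?F t} (\<lambda>(t, z). fst (g (z, t)))"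
      by (simp add: case_prod_beta)
    show "\<Psi> 0 x = x" if "x \<in> ?F 0" for x using triv that by (auto simp: path_trivialisation_def)
    fix t :: real assume t: "t \<in> {0..1}"
    show "\<Psi> t x \<in> ?F t" if "x \<in> ?F 0" for x using funcset_mem[OF T(2), of "(x, t)"] that t by simp
    show "fst (g (\<Psi> t x, t)) = x" if "x \<in> ?F 0" for x using gT[of "(x, t)"] that t by simp
    fix z assume z: "z \<in> ?F t"
    show "fst (g (z, t)) \<in> ?F 0" using funcset_mem[OF gc(2), of "(z, t)"] t z by (auto simp: mem_Times_iff)
    show "\<Psi> t (fst (g (z, t))) = z" using Tg[of "(z, t)"] t z by (auto simp: case_prod_beta)
  qed
qed

lemma path_trivialisationD:
  assumes "path_trivialisation \<phi> \<epsilon> \<gamma> \<Psi>"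
  shows "continuous_on ({0..1} \<times> fibre \<phi> \<epsilon> (\<gamma> 0)) (\<lambda>(t, x). \<Psi> t x)"
    and "t \<in> {0..1} \<Longrightarrow> x \<in> fibre \<phi> \<epsilon> (\<gamma> 0) \<Longrightarrow> \<Psi> t x \<in> fibre \<phi> \<epsilon> (\<gamma> t)"
    and "x \<in> fibre \<phi> \<epsilon> (\<gamma> 0) \<Longrightarrow> \<Psi> 0 x = x"
proof -
  show "continuous_on ({0..1} \<times> fibre \<phi> \<epsilon> (\<gamma> 0)) (\<lambda>(t, x). \<Psi> t x)"
    by (rule path_trivialisationE[OF assms])
  show "\<Psi> t x \<in> fibre \<phi> \<epsilon> (\<gamma> t)" if "t \<in> {0..1}" "x \<in> fibre \<phi> \<epsilon> (\<gamma> 0)"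
    using that by (rule_tac path_trivialisationE[OF assms]) simp
  show "\<Psi> 0 x = x" if "x \<in> fibre \<phi> \<epsilon> (\<gamma> 0)"
    using assms that by (auto simp: path_trivialisation_def)
qed

text \<open>The homotopy is \<open>\<Psi>\<^sub>1 \<circ> inverse \<Psi>\<^sub>t \<circ> \<Theta>\<^sub>t\<close>: the map \<open>\<Theta>\<^sub>t\<close> into the fibre over \<open>\<gamma> t\<close>, followed by
  transport along the remaining part of the path.\<close>

lemma trivialisation_homotopy:
  assumes triv: "path_trivialisation \<phi> \<epsilon> \<gamma> \<Psi>"
    and cont: "continuous_on ({0..1} \<times> fibre \<phi> \<epsilon> (\<gamma> 0)) (\<lambda>(t, x). \<Theta> t x)"
    and maps: "\<And>t x. t \<in> {0..1} \<Longrightarrow> x \<in> fibre \<phi> \<epsilon> (\<gamma> 0) \<Longrightarrow> \<Theta> t x \<in> fibre \<phi> \<epsilon> (\<gamma> t)"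
  shows "homotopic_with_canon (\<lambda>_. True) (fibre \<phi> \<epsilon> (\<gamma> 0)) (fibre \<phi> \<epsilon> (\<gamma> 1)) (\<Psi> 1 \<circ> \<Theta> 0) (\<Theta> 1)"
proof -
  let ?F = "\<lambda>t. fibre \<phi> \<epsilon> (\<gamma> t)"
  obtain G where \<Psi>: "continuous_on ({0..1} \<times> ?F 0) (\<lambda>(t, x). \<Psi> t x)"
      "\<And>t x. t \<in> {0..1} \<Longrightarrow> x \<in> ?F 0 \<Longrightarrow> \<Psi> t x \<in> ?F t" "\<And>x. x \<in> ?F 0 \<Longrightarrow> \<Psi> 0 x = x"
    and G: "continuous_on {(t, z). t \<in> {0..1} \<and> z \<in> ?F t} (\<lambda>(t, z). G t z)"
      "\<And>t z. t \<in> {0..1} \<Longrightarrow> z \<in> ?F t \<Longrightarrow> G t z \<in> ?F 0"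
    and inv: "\<And>t x. t \<in> {0..1} \<Longrightarrow> x \<in> ?F 0 \<Longrightarrow> G t (\<Psi> t x) = x"
      "\<And>t z. t \<in> {0..1} \<Longrightarrow> z \<in> ?F t \<Longrightarrow> \<Psi> t (G t z) = z"
    using path_trivialisationE[OF triv] by blast
  let ?h = "\<lambda>(t, x). \<Psi> 1 (G t (\<Theta> t x))"
  have "continuous_on ({0..1} \<times> ?F 0) (\<lambda>p. (\<lambda>(t, z). G t z) (fst p, (\<lambda>(t, x). \<Theta> t x) p))"
    by (rule continuous_on_compose2[OF G(1)]) (use maps cont in \<open>auto intro!: continuous_intros\<close>)
  then have "continuous_on ({0..1} \<times> ?F 0) (\<lambda>p. (\<lambda>(t, x). \<Psi> t x) (1, (\<lambda>(t, z). G t z) (fst p, (\<lambda>(t, x). \<Theta> t x) p)))"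
    by (intro continuous_on_compose2[OF \<Psi>(1)] continuous_on_Pair continuous_on_const) (use maps G(2) in auto)
  then have hcont: "continuous_on ({0..1} \<times> ?F 0) ?h" by (simp add: case_prod_beta)
  have him: "?h \<in> {0..1} \<times> ?F 0 \<rightarrow> ?F 1" using maps G(2) \<Psi>(2)[of 1] by auto
  have h0: "?h (0, x) = (\<Psi> 1 \<circ> \<Theta> 0) x" if "x \<in> ?F 0" for x
    using inv(1)[of 0 "\<Theta> 0 x"] \<Psi>(3)[of "\<Theta> 0 x"] maps[of 0 x] that by simp
  have h1: "?h (1, x) = \<Theta> 1 x" if "x \<in> ?F 0" for x using inv(2)[of 1 "\<Theta> 1 x"] maps[of 1 x] that by simp
  have prod: "prod_topology (top_of_set {0..1}) (top_of_set (?F 0)) = top_of_set ({0..1::real} \<times> ?F 0)"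
    by (simp add: subtopology_Times)
  show ?thesis
    unfolding homotopic_with[of "top_of_set (?F 0)" "\<lambda>_. True", simplified] prod
    by (intro exI[of _ ?h] conjI ballI)
       (use hcont him h0 h1 in \<open>auto simp: continuous_map_in_subtopology\<close>)
qed

lemma trivialisation_end_homeomorphic:
  assumes triv: "path_trivialisation \<phi> \<epsilon> \<gamma> \<Psi>"
  shows "homeomorphic_map (top_of_set (fibre \<phi> \<epsilon> (\<gamma> 0))) (top_of_set (fibre \<phi> \<epsilon> (\<gamma> 1))) (\<Psi> 1)"
proof -
  let ?F = "\<lambda>t. fibre \<phi> \<epsilon> (\<gamma> t)"
  obtain G where \<Psi>: "continuous_on ({0..1} \<times> ?F 0) (\<lambda>(t, x). \<Psi> t x)"
      "\<And>t x. t \<in> {0..1} \<Longrightarrow> x \<in> ?F 0 \<Longrightarrow> \<Psi> t x \<in> ?F t" "\<And>x. x \<in> ?F 0 \<Longrightarrow> \<Psi> 0 x = x"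
    and G: "continuous_on {(t, z). t \<in> {0..1} \<and> z \<in> ?F t} (\<lambda>(t, z). G t z)"
      "\<And>t z. t \<in> {0..1} \<Longrightarrow> z \<in> ?F t \<Longrightarrow> G t z \<in> ?F 0"
    and inv: "\<And>t x. t \<in> {0..1} \<Longrightarrow> x \<in> ?F 0 \<Longrightarrow> G t (\<Psi> t x) = x"
      "\<And>t z. t \<in> {0..1} \<Longrightarrow> z \<in> ?F t \<Longrightarrow> \<Psi> t (G t z) = z"
    using path_trivialisationE[OF triv] by blast
  have "continuous_on (?F 0) (\<lambda>x. (\<lambda>(t, x). \<Psi> t x) (1, x))"
    by (intro continuous_on_compose2[OF \<Psi>(1)] continuous_intros) auto
  moreover have "continuous_on (?F 1) (\<lambda>z. (\<lambda>(t, z). G t z) (1, z))"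
    by (intro continuous_on_compose2[OF G(1)] continuous_intros) auto
  ultimately have cont: "continuous_on (?F 0) (\<Psi> 1)" "continuous_on (?F 1) (G 1)" by simp_all
  have "homeomorphic_maps (top_of_set (?F 0)) (top_of_set (?F 1)) (\<Psi> 1) (G 1)"
    unfolding homeomorphic_maps_def continuous_map_in_subtopology continuous_map_iff_continuous
      topspace_euclidean_subtopology
    using \<Psi>(2)[of 1] G(2)[of 1] inv[of 1] cont by (intro conjI ballI funcsetI) simp_all
  then show ?thesis unfolding homeomorphic_map_maps by blast
qed

text \<open>For a second trivialisation \<open>\<Psi>'\<close>, the family \<open>\<Theta> = \<Psi>'\<close> in \<open>trivialisation_homotopy\<close> starts at the
  identity and gives a homotopy between the two end maps, so the description of the transport map is
  unique.\<close>

lemma homology_transport_eq: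
  assumes triv: "path_trivialisation \<phi> \<epsilon> \<gamma> \<Psi>"
  shows "homology_transport \<phi> \<epsilon> q \<gamma> =
    hom_induced q (top_of_set (fibre \<phi> \<epsilon> (\<gamma> 0))) {} (top_of_set (fibre \<phi> \<epsilon> (\<gamma> 1))) {} (\<Psi> 1)"
  unfolding homology_transport_def
proof (rule the_equality)
  let ?H = "hom_induced q (top_of_set (fibre \<phi> \<epsilon> (\<gamma> 0))) {} (top_of_set (fibre \<phi> \<epsilon> (\<gamma> 1))) {}"
  fix h assume "\<exists>\<Psi>'. path_trivialisation \<phi> \<epsilon> \<gamma> \<Psi>' \<and> h = ?H (\<Psi>' 1)"
  then obtain \<Psi>' where \<Psi>': "path_trivialisation \<phi> \<epsilon> \<gamma> \<Psi>'" "h = ?H (\<Psi>' 1)" by blast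
  have "?H (\<Psi> 1 \<circ> \<Psi>' 0) = ?H (\<Psi>' 1)"
    by (rule homology_homotopy_empty[OF trivialisation_homotopy[OF triv]])
       (use path_trivialisationD[OF \<Psi>'(1)] in auto)
  moreover have "?H (\<Psi> 1 \<circ> \<Psi>' 0) = ?H (\<Psi> 1)"
    using \<Psi>'(1) by (intro hom_induced_eq) (auto simp: path_trivialisation_def)
  ultimately show "h = ?H (\<Psi> 1)" using \<Psi>'(2) by simp
qed (use triv in blast)

lemma homology_transport_iso:
  assumes "path_trivialisation \<phi> \<epsilon> \<gamma> \<Psi>"
  shows "homology_transport \<phi> \<epsilon> q \<gamma> \<in> iso (fibre_homology \<phi> \<epsilon> q (\<gamma> 0)) (fibre_homology \<phi> \<epsilon> q (\<gamma> 1))"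
  unfolding homology_transport_eq[OF assms]
  by (rule homeomorphic_map_homology_iso[OF trivialisation_end_homeomorphic[OF assms]])

text \<open>A continuous bijection from a compact space to a Hausdorff space is a homeomorphism, so the
  continuity of the inverse comes for free.\<close>

lemma path_trivialisationI:
  assumes comp: "compact (fibre \<phi> \<epsilon> (\<gamma> 0))"
    and cont: "continuous_on ({0..1} \<times> UNIV) (\<lambda>(t, x). X t x)" and X0: "\<And>x. X 0 x = x"
    and bij: "\<And>t. t \<in> {0..1} \<Longrightarrow> bij_betw (X t) (fibre \<phi> \<epsilon> (\<gamma> 0)) (fibre \<phi> \<epsilon> (\<gamma> t))"
  shows "path_trivialisation \<phi> \<epsilon> \<gamma> X"
  unfolding path_trivialisation_def
proof
  let ?F = "\<lambda>t. fibre \<phi> \<epsilon> (\<gamma> t)"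
  let ?E = "{(x, t). t \<in> {0..1} \<and> x \<in> ?F t}"
  let ?T = "\<lambda>(x, t). (X t x, t)"
  have "continuous_on (?F 0 \<times> {0..1}) (\<lambda>p. ((\<lambda>(t, x). X t x) (snd p, fst p), snd p))"
    by (intro continuous_intros continuous_on_compose2[OF cont]) auto
  then have Tcont: "continuous_on (?F 0 \<times> {0..1}) ?T" by (simp add: case_prod_beta)
  have Tim: "?T ` (?F 0 \<times> {0..1}) = ?E"
  proof (intro equalityI subsetI)
    fix p assume "p \<in> ?T ` (?F 0 \<times> {0..1})"
    then obtain x t where p: "p = (X t x, t)" "x \<in> ?F 0" "t \<in> {0..1}" by auto
    then show "p \<in> ?E" using bij_betw_apply[OF bij[OF p(3)] p(2)] by simp
  next
    fix p assume "p \<in> ?E"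
    then obtain x t where p: "p = (x, t)" "t \<in> {0..1}" "x \<in> ?F t" by auto
    then obtain z where "z \<in> ?F 0" "x = X t z" using bij[OF p(2)] by (auto simp: bij_betw_def)
    then show "p \<in> ?T ` (?F 0 \<times> {0..1})" using p by (auto intro!: image_eqI[of _ _ "(z, t)"])
  qed
  have inj: "inj_on ?T (?F 0 \<times> {0..1})"
  proof (rule inj_onI)
    fix p p' assume p: "p \<in> ?F 0 \<times> {0..1}" "p' \<in> ?F 0 \<times> {0..1}" and eq: "?T p = ?T p'"
    then have "inj_on (X (snd p)) (?F 0)" "snd p = snd p'" "X (snd p) (fst p) = X (snd p) (fst p')"
      using bij[of "snd p"] by (auto simp: bij_betw_def case_prod_beta)
    then show "p = p'" using p by (auto simp: inj_on_def mem_Times_iff prod_eq_iff)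
  qed
  show "homeomorphic_map (top_of_set (?F 0 \<times> {0..1})) (top_of_set ?E) ?T"
  proof (rule continuous_imp_homeomorphic_map)
    show "continuous_map (top_of_set (?F 0 \<times> {0..1})) (top_of_set ?E) ?T"
      unfolding continuous_map_in_subtopology continuous_map_iff_continuous topspace_euclidean_subtopology
      by (intro conjI Tcont Tim[THEN equalityD1, unfolded image_subset_iff_funcset])
    show "compact_space (top_of_set (?F 0 \<times> {0..1::real}))"
      by (rule compact_space_subtopology, unfold compactin_euclidean_iff) (intro compact_Times comp compact_Icc)
    show "Hausdorff_space (top_of_set ?E)"
      by (intro Hausdorff_space_subtopology Hausdorff_space_euclidean)
  qed (use Tim inj in auto)
  show "\<forall>x\<in>?F 0. X 0 x = x" using X0 by simp
qed

text \<open>All loops \<open>\<alpha> s\<close> are trivialised by the same \<open>Y\<close>, so that \<open>\<Theta>\<^sub>s = Y\<^sub>1 \<circ> \<Psi>\<^sub>s\<close> is a continuous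
  family of maps to the fibres over \<open>\<gamma> s\<close>. It leads from \<open>Y\<^sub>1\<close> to \<open>Y\<^sub>1 \<circ> \<Psi>\<^sub>1\<close>, hence \<open>\<Psi>\<^sub>1 \<circ> Y\<^sub>1\<close> and \<open>Y\<^sub>1 \<circ> \<Psi>\<^sub>1\<close> are
  homotopic.\<close>

lemma transport_conjugates_monodromy:
  assumes \<Psi>: "path_trivialisation \<phi> \<epsilon> \<gamma> \<Psi>"
    and loops: "\<And>s. s \<in> {0..1} \<Longrightarrow> \<alpha> s 0 = \<gamma> s \<and> \<alpha> s 1 = \<gamma> s"
    and Y: "\<And>s. s \<in> {0..1} \<Longrightarrow> path_trivialisation \<phi> \<epsilon> (\<alpha> s) Y"
    and Ycont: "continuous_on UNIV (Y 1)"
  shows "homology_transport \<phi> \<epsilon> q \<gamma> (homology_transport \<phi> \<epsilon> q (\<alpha> 0) c) =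
    homology_transport \<phi> \<epsilon> q (\<alpha> 1) (homology_transport \<phi> \<epsilon> q \<gamma> c)"
proof -
  let ?F = "\<lambda>t. fibre \<phi> \<epsilon> (\<gamma> t)"
  let ?H = "\<lambda>s t. hom_induced q (top_of_set (?F s)) {} (top_of_set (?F t)) {}"
  note \<Psi>' = path_trivialisationD[OF \<Psi>]
  have Ymaps: "Y 1 x \<in> ?F s" if "s \<in> {0..1}" "x \<in> ?F s" for s x
    using path_trivialisationD(2)[OF Y[OF that(1)], of 1 x] loops[OF that(1)] that(2) by simp
  have mono: "homology_transport \<phi> \<epsilon> q (\<alpha> s) = ?H s s (Y 1)" if "s \<in> {0..1}" for s
    using homology_transport_eq[OF Y[OF that], of q] loops[OF that] by simp
  have \<Psi>map: "continuous_map (top_of_set (?F 0)) (top_of_set (?F 1)) (\<Psi> 1)"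
    by (rule homeomorphic_imp_continuous_map[OF trivialisation_end_homeomorphic[OF \<Psi>]])
  have Ymap: "continuous_map (top_of_set (?F s)) (top_of_set (?F s)) (Y 1)" if "s \<in> {0..1}" for s
    using continuous_on_subset[OF Ycont] Ymaps[OF that] by (auto simp: continuous_map_in_subtopology)
  have "homotopic_with_canon (\<lambda>_. True) (?F 0) (?F 1) (\<Psi> 1 \<circ> (Y 1 \<circ> \<Psi> 0)) (Y 1 \<circ> \<Psi> 1)"
  proof (rule trivialisation_homotopy[OF \<Psi>])
    have "continuous_on ({0..1} \<times> ?F 0) (\<lambda>p. Y 1 ((\<lambda>(t, x). \<Psi> t x) p))"
      by (intro continuous_on_compose2[OF Ycont] \<Psi>'(1)) auto
    then show "continuous_on ({0..1} \<times> ?F 0) (\<lambda>(t, x). (Y 1 \<circ> \<Psi> t) x)" by (simp add: case_prod_beta)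
  qed (use \<Psi>'(2) Ymaps in auto)
  then have "?H 0 1 (\<Psi> 1 \<circ> (Y 1 \<circ> \<Psi> 0)) = ?H 0 1 (Y 1 \<circ> \<Psi> 1)" by (rule homology_homotopy_empty)
  moreover have "?H 0 1 (\<Psi> 1 \<circ> (Y 1 \<circ> \<Psi> 0)) = ?H 0 1 (\<Psi> 1 \<circ> Y 1)"
    by (rule hom_induced_eq) (simp add: \<Psi>'(3))
  moreover have "?H 0 1 (\<Psi> 1 \<circ> Y 1) = ?H 0 1 (\<Psi> 1) \<circ> ?H 0 0 (Y 1)"
    using \<Psi>map Ymap[of 0] by (intro hom_induced_compose_empty) auto
  moreover have "?H 0 1 (Y 1 \<circ> \<Psi> 1) = ?H 1 1 (Y 1) \<circ> ?H 0 1 (\<Psi> 1)"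
    using \<Psi>map Ymap[of 1] by (intro hom_induced_compose_empty) auto
  ultimately have "?H 0 1 (\<Psi> 1) \<circ> ?H 0 0 (Y 1) = ?H 1 1 (Y 1) \<circ> ?H 0 1 (\<Psi> 1)" by simp
  then show ?thesis
    by (simp add: homology_transport_eq[OF \<Psi>] mono fun_eq_iff)
qed


section \<open>Holomorphic maps of several variables\<close>

lemma norm_vector_smult: "norm (c *s x) = cmod c * norm (x :: complex ^ 'n)"
  by (simp add: norm_vec_def norm_mult L2_set_right_distrib)

lemma bounded_bilinear_smult: "bounded_bilinear (\<lambda>c (x :: complex ^ 'n). c *s x)"
  by unfold_locales
     (auto simp: vec_eq_iff norm_vector_smult algebra_simps intro: exI[of _ 1])

lemmas bounded_linear_smult_left = bounded_bilinear.bounded_linear_left[OF bounded_bilinear_smult]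

lemmas continuous_on_smult = bounded_bilinear.continuous_on[OF bounded_bilinear_smult]

lemma holomorphic_on_complex_line:
  fixes g :: "complex ^ 'p \<Rightarrow> complex"
  assumes "holomorphic_fun_on g V"
  shows "(\<lambda>s. g (a + s *s d)) holomorphic_on {s. a + s *s d \<in> V}"
  unfolding holomorphic_on_def
proof
  fix s assume "s \<in> {s. a + s *s d \<in> V}"
  then obtain c :: "complex ^ 'p" where
    c: "(g has_derivative (\<lambda>v. \<Sum>i\<in>UNIV. c $ i * v $ i)) (at (a + s *s d))"
    using assms unfolding holomorphic_fun_on_def by blast
  have "((\<lambda>s. a + s *s d) has_derivative (\<lambda>h. 0 + h *s d)) (at s within {s. a + s *s d \<in> V})"
    by (intro has_derivative_add has_derivative_const
        bounded_linear.has_derivative[OF bounded_linear_smult_left] has_derivative_ident)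
  then have "((\<lambda>s. g (a + s *s d)) has_derivative (\<lambda>h. \<Sum>i\<in>UNIV. c $ i * (0 + h *s d) $ i))
      (at s within {s. a + s *s d \<in> V})"
    by (rule has_derivative_compose) (rule c)
  moreover have "(\<lambda>h. \<Sum>i\<in>UNIV. c $ i * (0 + h *s d) $ i) = (*) (\<Sum>i\<in>UNIV. c $ i * d $ i)"
    by (simp add: fun_eq_iff sum_distrib_left mult_ac)
  ultimately show "(\<lambda>s. g (a + s *s d)) field_differentiable (at s within {s. a + s *s d \<in> V})"
    unfolding field_differentiable_def has_field_derivative_def by metis
qed

lemma holomorphic_fun_on_continuous:
  assumes "holomorphic_fun_on g V" shows "continuous_on V g"
  using assms unfolding holomorphic_fun_on_def
  by (meson continuous_at_imp_continuous_on has_derivative_continuous)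

text \<open>Cauchy's inequality for the restriction of each component of \<open>\<psi>\<close> to the complex line
  through \<open>x\<close> in the direction \<open>v\<close>.\<close>

lemma Cauchy_derivative_estimate:
  fixes \<psi> :: "complex ^ 'n \<Rightarrow> complex ^ 'p" and A :: "complex ^ 'n \<Rightarrow> complex ^ 'n ^ 'p"
  assumes der: "\<And>z. z \<in> ball x r \<Longrightarrow> (\<psi> has_derivative (\<lambda>v. A z *v v)) (at z)"
    and bound: "\<And>z. z \<in> ball x r \<Longrightarrow> norm (\<psi> z) \<le> B" and s: "0 < s" "s < r"
  shows "norm (A x *v v) \<le> real CARD('p) * B / s * norm v"
proof (cases "v = 0")
  case False
  define \<rho> where "\<rho> = s / norm v"
  have \<rho>: "\<rho> > 0" using s False by (simp add: \<rho>_def)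
  have inball: "x + t *s v \<in> ball x r" if "cmod t \<le> \<rho>" for t
  proof -
    have "cmod t * norm v \<le> s" using that False by (simp add: \<rho>_def field_simps)
    then show ?thesis using s by (simp add: dist_norm norm_vector_smult)
  qed
  have comp: "cmod ((A x *v v) $ i) \<le> B / s * norm v" for i
  proof -
    define h where "h t = \<psi> (x + t *s v) $ i" for t
    have dh: "(h has_field_derivative (A (x + t *s v) *v v) $ i) (at t)" if "cmod t \<le> \<rho>" for t
    proof -
      have "((\<lambda>t. x + t *s v) has_derivative (\<lambda>c. 0 + c *s v)) (at t)"
        by (intro has_derivative_add has_derivative_const
            bounded_linear.has_derivative[OF bounded_linear_smult_left] has_derivative_ident)
      then have "((\<lambda>t. \<psi> (x + t *s v)) has_derivative (\<lambda>c. A (x + t *s v) *v (0 + c *s v))) (at t)"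
        by (rule has_derivative_compose) (rule der[OF inball[OF that]])
      then have "(h has_derivative (\<lambda>c. (A (x + t *s v) *v (0 + c *s v)) $ i)) (at t)"
        unfolding h_def by (rule bounded_linear.has_derivative[OF bounded_linear_vec_nth])
      moreover have "(\<lambda>c. (A (x + t *s v) *v (0 + c *s v)) $ i) = (*) ((A (x + t *s v) *v v) $ i)"
        by (simp add: fun_eq_iff vector_scalar_commute mult.commute)
      ultimately show ?thesis by (simp add: has_field_derivative_def)
    qed
    have "cmod ((deriv ^^ 1) h 0) \<le> fact 1 * B / \<rho> ^ 1"
    proof (rule Cauchy_inequality[OF _ _ \<rho>])
      show "h holomorphic_on ball 0 \<rho>"
        unfolding holomorphic_on_open[OF open_ball] using dh by (force simp: less_imp_le)
      show "continuous_on (cball 0 \<rho>) h"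
        by (intro continuous_at_imp_continuous_on ballI DERIV_isCont[OF dh]) simp
      fix t assume "cmod (0 - t) = \<rho>"
      then have "norm (\<psi> (x + t *s v)) \<le> B" by (intro bound inball) simp
      then show "cmod (h t) \<le> B"
        unfolding h_def using order_trans[OF Finite_Cartesian_Product.norm_nth_le] by blast
    qed
    moreover have "deriv h 0 = (A x *v v) $ i" using DERIV_imp_deriv[OF dh[of 0]] \<rho> by simp
    ultimately show ?thesis by (simp add: \<rho>_def)
  qed
  have "norm (A x *v v) \<le> (\<Sum>i\<in>UNIV. norm ((A x *v v) $ i))"
    unfolding norm_vec_def by (intro L2_set_le_sum) simp
  also have "\<dots> \<le> (\<Sum>i\<in>(UNIV :: 'p set). B / s * norm v)" by (intro sum_mono comp)
  finally show ?thesis by (simp add: mult.assoc)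
qed simp

text \<open>Complex differentiability at every point is the only assumption, so the regularity of the
  derivative has to come from Cauchy's inequality. It first bounds the derivative, which makes \<open>\<phi>\<close>
  Lipschitz. Applied to the difference of \<open>\<phi>\<close> and its translate by \<open>y - x\<close>, which is of size \<open>O(\<bar>x - y\<bar>)\<close>,
  it then bounds the difference of the derivatives at \<open>x\<close> and \<open>y\<close>. Each of the two steps costs a
  neighbourhood of radius \<open>e\<close>, and the compact ball of radius \<open>4 * e\<close> provides a bound for \<open>\<phi>\<close>.\<close>

lemma holomorphic_derivative_bdd_lipschitz:
  fixes \<phi> :: "complex ^ 'n \<Rightarrow> complex ^ 'p"
  assumes hol: "holomorphic_map_on \<phi> U" and e: "e > 0" and U: "cball 0 (4 * e) \<subseteq> U"
  obtains D where "\<And>x. x \<in> ball 0 (2 * e) \<Longrightarrow> (\<phi> has_derivative blinfun_apply (D x)) (at x)"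
    "bdd_lipschitz_on (ball 0 (2 * e)) D"
proof -
  obtain A :: "complex ^ 'n \<Rightarrow> complex ^ 'n ^ 'p" where
    A: "\<And>z. z \<in> U \<Longrightarrow> (\<phi> has_derivative (\<lambda>v. A z *v v)) (at z)"
    using hol unfolding holomorphic_map_on_def by metis
  have AU: "(\<phi> has_derivative (\<lambda>v. A z *v v)) (at z)" if "norm z \<le> 4 * e" for z
    using A U that by (simp add: subset_iff)
  have "continuous_on (cball 0 (4 * e)) \<phi>"
    by (intro continuous_at_imp_continuous_on ballI has_derivative_continuous[OF AU]) simp
  then have "bounded (\<phi> ` cball 0 (4 * e))"
    by (intro compact_imp_bounded compact_continuous_image compact_cball)
  then obtain M where M: "\<And>z. norm z \<le> 4 * e \<Longrightarrow> norm (\<phi> z) \<le> M"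
    unfolding bounded_iff by (metis image_eqI mem_cball_0)
  have M0: "M \<ge> 0" using order_trans[OF norm_ge_zero M[of 0]] e by simp
  define m where "m = real CARD('p) * M / (e / 2)"
  have m0: "m \<ge> 0" using M0 e by (simp add: m_def)
  have near: "norm z \<le> c + e" if "z \<in> ball x e" "norm x < c" for z x :: "complex ^ 'n" and c
    using that norm_triangle_ineq4[of x "x - z"] by (simp add: dist_norm)
  have bd: "norm (A x *v v) \<le> m * norm v" if "norm x < 3 * e" for x v
    unfolding m_def
    by (rule Cauchy_derivative_estimate[of x e \<phi> A M "e / 2"])
       (use e AU M near[OF _ that] in \<open>auto simp: algebra_simps\<close>)
  have \<phi>lip: "norm (\<phi> x - \<phi> y) \<le> m * norm (x - y)" if "norm x < 3 * e" "norm y < 3 * e" for x y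
  proof (rule differentiable_bound[of "ball 0 (3 * e)" \<phi> "\<lambda>z v. A z *v v"])
    fix z :: "complex ^ 'n" assume "z \<in> ball 0 (3 * e)"
    then have z: "norm z < 3 * e" by simp
    show "(\<phi> has_derivative (\<lambda>v. A z *v v)) (at z within ball 0 (3 * e))"
      by (rule has_derivative_at_withinI[OF AU]) (use z e in simp)
    show "onorm (\<lambda>v. A z *v v) \<le> m" by (rule onorm_le[OF bd[OF z]])
  qed (use that in auto)
  define D where "D x = Blinfun (\<lambda>v. A x *v v)" for x
  have D: "blinfun_apply (D x) = (\<lambda>v. A x *v v)" if "norm x \<le> 4 * e" for x
    unfolding D_def by (rule bounded_linear_Blinfun_apply[OF has_derivative_bounded_linear[OF AU[OF that]]])
  show ?thesis
  proof (rule that[of D])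
    show "(\<phi> has_derivative blinfun_apply (D x)) (at x)" if "x \<in> ball 0 (2 * e)" for x
      using AU[of x] D[of x] that e by simp
    show "bdd_lipschitz_on (ball 0 (2 * e)) D"
    proof (rule bdd_lipschitz_onI[of _ _ m "real CARD('p) * m / (e / 2)"])
      fix x :: "complex ^ 'n" assume x: "x \<in> ball 0 (2 * e)"
      then show "norm (D x) \<le> m" using bd[of x] D[of x] m0 e by (intro norm_blinfun_bound) auto
      fix y :: "complex ^ 'n" assume y: "y \<in> ball 0 (2 * e)"
      show "norm (D x - D y) \<le> real CARD('p) * m / (e / 2) * dist x y"
      proof (rule norm_blinfun_bound)
        fix v
        define \<psi> where "\<psi> z = \<phi> z - \<phi> (z + (y - x))" for z
        have "norm ((A x - A (x + (y - x))) *v v) \<le> real CARD('p) * (m * dist x y) / (e / 2) * norm v"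
        proof (rule Cauchy_derivative_estimate[of x e \<psi> "\<lambda>z. A z - A (z + (y - x))" "m * dist x y" "e / 2"])
          fix z assume z: "z \<in> ball x e"
          have z1: "norm z < 3 * e" and z2: "norm (z + (y - x)) < 3 * e"
            using z x y norm_triangle_ineq4[of x "x - z"] norm_triangle_ineq4[of y "x - z"]
            by (auto simp: dist_norm algebra_simps)
          have "((\<lambda>z. z + (y - x)) has_derivative (\<lambda>v. v)) (at z)"
            by (auto intro!: derivative_eq_intros)
          then have "((\<lambda>z. \<phi> (z + (y - x))) has_derivative (\<lambda>v. A (z + (y - x)) *v v)) (at z)"
            by (rule has_derivative_compose) (use AU z2 e in simp)
          then have "(\<psi> has_derivative (\<lambda>v. A z *v v - A (z + (y - x)) *v v)) (at z)"
            unfolding \<psi>_def by (intro has_derivative_diff AU) (use z1 e in simp)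
          then show "(\<psi> has_derivative (\<lambda>v. (A z - A (z + (y - x))) *v v)) (at z)"
            by (simp add: matrix_vector_mult_diff_rdistrib)
          show "norm (\<psi> z) \<le> m * dist x y"
            using \<phi>lip[OF z1 z2] by (simp add: \<psi>_def dist_norm norm_minus_commute)
        qed (use e in auto)
        then show "norm ((D x - D y) v) \<le> real CARD('p) * m / (e / 2) * dist x y * norm v"
          using D[of x] D[of y] x y e by (simp add: blinfun.diff_left matrix_vector_mult_diff_rdistrib mult_ac)
      qed (use m0 e in simp)
    qed
  qed
qed


section \<open>The initial form and paths between directions\<close>

text \<open>Taylor's formula for \<open>t \<mapsto> g (t z)\<close>, with a remainder that Cauchy's inequality bounds uniformly
  for \<open>z\<close> in a ball.\<close>

lemma lowest_homogeneous_part_approximates: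
  fixes g :: "complex ^ 'p \<Rightarrow> complex"
  assumes g: "holomorphic_fun_on g V" and V: "open V" "0 \<in> V"
    and low: "\<And>j z. j < k \<Longrightarrow> homogeneous_part j g z = 0"
    and R: "R > 0"
  obtains r B where "r > 0" "B \<ge> 0"
    "\<And>z t. norm z \<le> R \<Longrightarrow> cmod t \<le> r \<Longrightarrow> t *s z \<in> V \<and>
      cmod (g (t *s z) - t ^ k * homogeneous_part k g z) \<le> B * cmod t ^ Suc k"
proof -
  obtain \<rho> where \<rho>: "\<rho> > 0" "cball 0 \<rho> \<subseteq> V" using V open_contains_cball by blast
  have "compact (g ` cball 0 \<rho>)"
    by (intro compact_continuous_image continuous_on_subset[OF holomorphic_fun_on_continuous[OF g] \<rho>(2)] compact_cball)
  then have "bounded (g ` cball 0 \<rho>)" by (rule compact_imp_bounded)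
  then obtain M where M: "\<And>z. norm z \<le> \<rho> \<Longrightarrow> cmod (g z) \<le> M"
    unfolding bounded_iff by (metis image_eqI mem_cball_0)
  have M0: "M \<ge> 0" using order_trans[OF norm_ge_zero M[of 0]] \<rho> by simp
  define r where "r = \<rho> / R"
  have r: "r > 0" using \<rho> R by (simp add: r_def)
  have small: "norm (t *s z) \<le> \<rho>" if "norm z \<le> R" "cmod t \<le> r" for z :: "complex ^ 'p" and t
  proof -
    have "norm (t *s z) \<le> r * R" unfolding norm_vector_smult using that r by (intro mult_mono) auto
    then show ?thesis using R by (simp add: r_def)
  qed
  define B where "B = fact (Suc k) * M / (r / 2) ^ Suc k / fact k"
  have B0: "B \<ge> 0" using M0 r by (simp add: B_def)
  have "t *s z \<in> V \<and> cmod (g (t *s z) - t ^ k * homogeneous_part k g z) \<le> B * cmod t ^ Suc k"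
    if z: "norm z \<le> R" and t: "cmod t \<le> r / 4" for z t
  proof
    show "t *s z \<in> V" using small[OF z, of t] t r \<rho>(2) by (auto simp: subset_iff)
    define f where "f t = g (t *s z)" for t
    have holf: "f holomorphic_on ball 0 r"
    proof -
      have "f holomorphic_on {s. 0 + s *s z \<in> V}"
        using holomorphic_on_complex_line[OF g, of 0 z] by (simp add: f_def[abs_def])
      then show ?thesis
        by (rule holomorphic_on_subset) (use small[OF z] \<rho>(2) in \<open>auto simp: subset_iff\<close>)
    qed
    have bound: "cmod ((deriv ^^ Suc k) f w) \<le> fact (Suc k) * M / (r / 2) ^ Suc k" if "w \<in> cball 0 (r / 4)" for w
    proof (rule Cauchy_inequality)
      have sub: "cball w (r / 2) \<subseteq> ball 0 r"
      proof
        fix x assume "x \<in> cball w (r / 2)"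
        then have "cmod (w - x) \<le> r / 2" "cmod w \<le> r / 4" using that by (auto simp: dist_norm)
        then show "x \<in> ball 0 r" using norm_triangle_ineq4[of w "w - x"] r by simp
      qed
      show "f holomorphic_on ball w (r / 2)"
        by (rule holomorphic_on_subset[OF holf]) (use sub ball_subset_cball in blast)
      show "continuous_on (cball w (r / 2)) f"
        by (rule holomorphic_on_imp_continuous_on[OF holomorphic_on_subset[OF holf sub]])
      show "cmod (f x) \<le> M" if "cmod (w - x) = r / 2" for x
      proof -
        have "x \<in> ball 0 r" using sub that by (auto simp: dist_norm)
        then show ?thesis unfolding f_def by (intro M small z) simp
      qed
    qed (use r in simp)
    have "cmod (f t - (\<Sum>i\<le>k. (deriv ^^ i) f 0 * (t - 0) ^ i / fact i))
        \<le> (fact (Suc k) * M / (r / 2) ^ Suc k) * cmod (t - 0) ^ Suc k / fact k"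
    proof (rule complex_Taylor[of "cball 0 (r / 4)" k "\<lambda>i. (deriv ^^ i) f", simplified funpow_0])
      fix i and x :: complex assume "x \<in> cball 0 (r / 4)" "i \<le> k"
      then have "((deriv ^^ i) f has_field_derivative deriv ((deriv ^^ i) f) x) (at x)"
        by (intro holomorphic_derivI[of _ "ball 0 r"] holomorphic_higher_deriv holf) (use r in auto)
      then show "((deriv ^^ i) f has_field_derivative (deriv ^^ Suc i) f x) (at x within cball 0 (r / 4))"
        by (simp add: has_field_derivative_at_within)
    qed (use bound t r in auto)
    also have "(\<Sum>i\<le>k. (deriv ^^ i) f 0 * (t - 0) ^ i / fact i) = (\<Sum>i\<le>k. homogeneous_part i g z * t ^ i)"
      by (simp add: homogeneous_part_def f_def[abs_def])
    also have "\<dots> = (\<Sum>i\<in>{k}. homogeneous_part i g z * t ^ i)"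
      by (rule sum.mono_neutral_right) (auto simp: low)
    finally show "cmod (g (t *s z) - t ^ k * homogeneous_part k g z) \<le> B * cmod t ^ Suc k"
      by (simp add: f_def B_def mult_ac)
  qed
  then show ?thesis using that[of "r / 4" B] r B0 by auto
qed

text \<open>The homogeneous part is defined by derivatives in an auxiliary variable, so its dependence on
  \<open>z\<close> is not visible. For the lowest degree it is the locally uniform limit of \<open>z \<mapsto> g (t z) / t\<^sup>k\<close> as \<open>t\<close>
  tends to 0.\<close>

lemma homogeneous_part_holomorphic_on_line:
  fixes g :: "complex ^ 'p \<Rightarrow> complex"
  assumes g: "holomorphic_fun_on g V" and V: "open V" "0 \<in> V"
    and low: "\<And>j z. j < k \<Longrightarrow> homogeneous_part j g z = 0"
  shows "(\<lambda>s. homogeneous_part k g (a + s *s d)) holomorphic_on UNIV"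
proof -
  have "(\<lambda>s. homogeneous_part k g (a + s *s d)) holomorphic_on ball s0 1" for s0
  proof -
    define R where "R = norm a + (cmod s0 + 1) * norm d + 1"
    have R: "R > 0" by (simp add: R_def add_nonneg_pos)
    have le: "norm (a + s *s d) \<le> R" if "s \<in> cball s0 1" for s
    proof -
      have "cmod s \<le> cmod s0 + 1"
        using that norm_triangle_ineq2[of s s0] by (simp add: dist_norm norm_minus_commute)
      then have "cmod s * norm d \<le> (cmod s0 + 1) * norm d" by (intro mult_right_mono) auto
      then show ?thesis using norm_triangle_ineq[of a "s *s d"] by (simp add: R_def norm_vector_smult)
    qed
    obtain r B where r: "r > 0" "B \<ge> 0" "\<And>z t. norm z \<le> R \<Longrightarrow> cmod t \<le> r \<Longrightarrow> t *s z \<in> V \<and>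
        cmod (g (t *s z) - t ^ k * homogeneous_part k g z) \<le> B * cmod t ^ Suc k"
      using lowest_homogeneous_part_approximates[OF g V low R] by blast
    \<comment> \<open>a null sequence of admissible values of \<open>t\<close>\<close>
    define \<tau> where "\<tau> n = complex_of_real (r / real (Suc n))" for n
    have \<tau>: "\<tau> n \<noteq> 0" "cmod (\<tau> n) \<le> r" "cmod (\<tau> n) = r / real (Suc n)" for n
      using r(1) by (auto simp: \<tau>_def norm_divide divide_simps mult_left_le simp del: of_nat_Suc)
    define q where "q n s = g (\<tau> n *s a + s *s (\<tau> n *s d)) / \<tau> n ^ k" for n s
    have arg: "\<tau> n *s a + s *s (\<tau> n *s d) = \<tau> n *s (a + s *s d)" for n s
      by (simp add: vec_eq_iff algebra_simps)
    have hol: "q n holomorphic_on cball s0 1" for n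
      unfolding q_def
    proof (intro holomorphic_intros holomorphic_on_subset[OF holomorphic_on_complex_line[OF g]] subsetI)
      fix s assume "s \<in> cball s0 1"
      then show "s \<in> {s. \<tau> n *s a + s *s (\<tau> n *s d) \<in> V}"
        unfolding mem_Collect_eq arg using r(3)[OF le \<tau>(2)] by blast
    qed (use \<tau>(1) in simp)
    have est: "cmod (q n s - homogeneous_part k g (a + s *s d)) \<le> B * r / real (Suc n)"
      if "s \<in> cball s0 1" for n s
    proof -
      have "q n s - homogeneous_part k g (a + s *s d)
          = (g (\<tau> n *s (a + s *s d)) - \<tau> n ^ k * homogeneous_part k g (a + s *s d)) / \<tau> n ^ k"
        unfolding q_def arg diff_divide_distrib using \<tau>(1)[of n] by simp
      then have "cmod (q n s - homogeneous_part k g (a + s *s d))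
          = cmod (g (\<tau> n *s (a + s *s d)) - \<tau> n ^ k * homogeneous_part k g (a + s *s d)) / cmod (\<tau> n) ^ k"
        by (simp only: norm_divide norm_power)
      also have "\<dots> \<le> (B * cmod (\<tau> n) ^ Suc k) / cmod (\<tau> n) ^ k"
        using r(3)[OF le[OF that] \<tau>(2)[of n]] by (intro divide_right_mono) auto
      also have "\<dots> = B * cmod (\<tau> n)" using \<tau>(1)[of n] by simp
      finally show ?thesis by (simp add: \<tau>(3))
    qed
    have ul: "uniform_limit (cball s0 1) q (\<lambda>s. homogeneous_part k g (a + s *s d)) sequentially"
    proof (rule uniform_limitI)
      fix e :: real assume e: "e > 0"
      have "(\<lambda>n. B * r / real (Suc n)) \<longlonglongrightarrow> 0"
        using tendsto_mult_right_zero[OF LIMSEQ_inverse_real_of_nat, of "B * r"] by (simp add: divide_inverse)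
      then have "\<forall>\<^sub>F n in sequentially. B * r / real (Suc n) < e"
        by (rule order_tendstoD(2)[OF _ e])
      then show "\<forall>\<^sub>F n in sequentially. \<forall>s\<in>cball s0 1. dist (q n s) (homogeneous_part k g (a + s *s d)) < e"
        by eventually_elim (auto simp: dist_norm intro: le_less_trans[OF est])
    qed
    show ?thesis
    proof (rule holomorphic_uniform_limit[OF _ ul sequentially_bot])
      show "\<forall>\<^sub>F n in sequentially. continuous_on (cball s0 1) (q n) \<and> q n holomorphic_on ball s0 1"
        by (intro always_eventually allI conjI holomorphic_on_imp_continuous_on[OF hol]
            holomorphic_on_subset[OF hol ball_subset_cball])
    qed
  qed
  then show ?thesis
    unfolding holomorphic_on_def
    by (metis UNIV_I at_within_open centre_in_ball open_UNIV open_ball zero_less_one)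
qed

text \<open>On the complex line through \<open>u\<close> and \<open>u'\<close> the lowest homogeneous part is a holomorphic function
  of one variable that is not identically zero. Its zeros are countable, so some path \<open>\<kappa>\<close> from \<open>u\<close> to \<open>u'\<close>
  avoids them. By the preceding estimate \<open>g\<close> has no zeros \<open>c *s \<kappa> t\<close> with \<open>c \<noteq> 0\<close> small. For any two small
  factors \<open>a\<close> and \<open>b\<close>, the product of \<open>\<kappa>\<close> with a path from \<open>a\<close> to \<open>b\<close> in a punctured disc joins
  \<open>a *s u\<close> to \<open>b *s u'\<close>, and it keeps away from the zeros of \<open>g\<close> together with all its rotations. A
  polynomial approximation makes it smooth.\<close>

lemma path_avoiding_zeros_of_initial_form:
  fixes g :: "complex ^ 'p \<Rightarrow> complex"
  assumes g: "holomorphic_fun_on g V" and V: "open V" "0 \<in> V"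
    and low: "\<And>j z. j < k \<Longrightarrow> homogeneous_part j g z = 0"
    and u: "homogeneous_part k g u \<noteq> 0" and u': "homogeneous_part k g u' \<noteq> 0"
    and W: "open W" "0 \<in> W"
  obtains \<eta> where "\<eta> > 0"
    "\<And>a b. 0 < cmod a \<Longrightarrow> cmod a < \<eta> \<Longrightarrow> 0 < cmod b \<Longrightarrow> cmod b < \<eta> \<Longrightarrow>
      \<exists>\<gamma>. polynomial_function \<gamma> \<and> \<gamma> 0 = a *s u \<and> \<gamma> 1 = b *s u' \<and>
        (\<forall>s\<in>{0..1::real}. \<forall>c. cmod c = 1 \<longrightarrow> c *s \<gamma> s \<in> W \<inter> V \<and> g (c *s \<gamma> s) \<noteq> 0)"
proof -
  define P where "P s = homogeneous_part k g (u + s *s (u' - u))" for s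
  have holP: "P holomorphic_on UNIV"
    unfolding P_def by (rule homogeneous_part_holomorphic_on_line[OF g V low])
  have P01: "P 0 \<noteq> 0" "P 1 \<noteq> 0" using u u' by (simp_all add: P_def)
  have "countable {s. P s = 0}"
  proof (cases "P constant_on UNIV")
    case True
    then have "{s. P s = 0} = {}" using P01 by (auto simp: constant_on_def)
    then show ?thesis by simp
  next
    case False
    then show ?thesis using holomorphic_countable_zeros[OF holP open_UNIV connected_UNIV] by simp
  qed
  then have "path_connected (- {s. P s = 0})"
    by (intro path_connected_complement_countable) simp_all
  from this[unfolded path_connected_def, rule_format, of 0 1] P01
  obtain \<sigma> where \<sigma>: "path \<sigma>" "path_image \<sigma> \<subseteq> - {s. P s = 0}" "pathstart \<sigma> = 0" "pathfinish \<sigma> = 1"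
    by auto
  have \<sigma>cont: "continuous_on {0..1} \<sigma>" using \<sigma>(1) by (simp add: path_def)
  define \<kappa> where "\<kappa> t = u + \<sigma> t *s (u' - u)" for t
  have \<kappa>cont: "continuous_on {0..1} \<kappa>"
    unfolding \<kappa>_def
    by (intro continuous_intros bounded_linear.continuous_on[OF bounded_linear_smult_left \<sigma>cont])
  have \<kappa>ends: "\<kappa> 0 = u" "\<kappa> 1 = u'" using \<sigma>(3,4) by (simp_all add: \<kappa>_def pathstart_def pathfinish_def)
  have "bounded (\<kappa> ` {0..1})" by (intro compact_imp_bounded compact_continuous_image \<kappa>cont compact_Icc)
  then obtain R where R: "R > 0" "\<And>t. t \<in> {0..1} \<Longrightarrow> norm (\<kappa> t) \<le> R"
    unfolding bounded_pos by (metis image_eqI)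
  have "continuous_on {0..1} (\<lambda>t. cmod (P (\<sigma> t)))"
    by (intro continuous_on_norm continuous_on_compose2[OF holomorphic_on_imp_continuous_on[OF holP] \<sigma>cont]) simp
  then obtain t0 where t0: "t0 \<in> {0..1}" "\<And>t. t \<in> {0..1} \<Longrightarrow> cmod (P (\<sigma> t0)) \<le> cmod (P (\<sigma> t))"
    using continuous_attains_inf[of "{0..1::real}" "\<lambda>t. cmod (P (\<sigma> t))"] by auto
  define m where "m = cmod (P (\<sigma> t0))"
  have m: "m > 0"
  proof -
    have "\<sigma> t0 \<in> - {s. P s = 0}" using \<sigma>(2) t0(1) unfolding path_image_def by blast
    then show ?thesis by (simp add: m_def)
  qed
  have m_le: "m \<le> cmod (homogeneous_part k g (\<kappa> t))" if "t \<in> {0..1}" for t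
    using t0(2)[OF that] by (simp add: m_def P_def \<kappa>_def)
  obtain r B where r: "r > 0" "B \<ge> 0" "\<And>z t. norm z \<le> R \<Longrightarrow> cmod t \<le> r \<Longrightarrow> t *s z \<in> V \<and>
      cmod (g (t *s z) - t ^ k * homogeneous_part k g z) \<le> B * cmod t ^ Suc k"
    using lowest_homogeneous_part_approximates[OF g V low R(1)] by blast
  obtain w where w: "w > 0" "ball 0 w \<subseteq> W" using W open_contains_ball by blast
  \<comment> \<open>The three bounds make the estimate available, keep the points in \<open>W\<close>, and let the leading term dominate.\<close>
  define \<eta> where "\<eta> = min r (min (w / R) (m / (B + 1)))"
  have \<eta>: "\<eta> > 0" "\<eta> \<le> r" "\<eta> \<le> w / R" "\<eta> \<le> m / (B + 1)" using r w R m by (auto simp: \<eta>_def)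
  let ?G = "{z \<in> W \<inter> V. g z \<noteq> 0}"
  have good: "c *s \<kappa> t \<in> ?G" if c: "0 < cmod c" "cmod c < \<eta>" and t: "t \<in> {0..1}" for c t
  proof -
    have "cmod c \<le> r" using c \<eta> by simp
    note est = r(3)[OF R(2)[OF t] this]
    have "cmod c * norm (\<kappa> t) \<le> cmod c * R" using R(2)[OF t] by (intro mult_left_mono) auto
    also have "\<dots> < \<eta> * R" using c(2) R(1) by (rule mult_strict_right_mono)
    also have "\<dots> \<le> w" using \<eta>(3) R(1) by (simp add: pos_le_divide_eq)
    finally have "c *s \<kappa> t \<in> W" using w by (auto simp: norm_vector_smult)
    moreover have "g (c *s \<kappa> t) \<noteq> 0"
    proof
      assume "g (c *s \<kappa> t) = 0"
      then have "cmod c ^ k * cmod (homogeneous_part k g (\<kappa> t)) \<le> B * cmod c ^ Suc k"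
        using est by (simp add: norm_mult norm_power)
      then have "cmod (homogeneous_part k g (\<kappa> t)) \<le> B * cmod c"
        using c(1) by (simp add: mult_ac)
      also have "\<dots> \<le> B * (m / (B + 1))" using c(2) \<eta>(4) r(2) by (intro mult_left_mono) auto
      also have "\<dots> < m" using m r(2) by (simp add: field_simps)
      finally show False using m_le[OF t] by simp
    qed
    ultimately show ?thesis using est by simp
  qed
  have openG: "open ?G"
  proof -
    have "open ((W \<inter> V) \<inter> g -` (- {0}))"
      by (intro continuous_open_preimage continuous_on_subset[OF holomorphic_fun_on_continuous[OF g]] open_Int W V)
         auto
    also have "(W \<inter> V) \<inter> g -` (- {0}) = ?G" by blast
    finally show ?thesis .
  qed
  show ?thesis
  proof (rule that[OF \<eta>(1)])
    fix a b :: complex assume ab: "0 < cmod a" "cmod a < \<eta>" "0 < cmod b" "cmod b < \<eta>"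
    have "path_connected (ball (0::complex) \<eta> - {0})"
      using \<eta> by (intro path_connected_punctured_convex) (auto simp: aff_dim_open)
    from this[unfolded path_connected_def, rule_format, of a b] ab
    obtain \<tau> where \<tau>: "path \<tau>" "path_image \<tau> \<subseteq> ball 0 \<eta> - {0}" "pathstart \<tau> = a" "pathfinish \<tau> = b"
      by auto
    have \<tau>b: "0 < cmod (\<tau> t)" "cmod (\<tau> t) < \<eta>" if "t \<in> {0..1}" for t
    proof -
      have "\<tau> t \<in> ball 0 \<eta> - {0}" using \<tau>(2) that unfolding path_image_def by blast
      then show "0 < cmod (\<tau> t)" "cmod (\<tau> t) < \<eta>" by simp_all
    qed
    have \<tau>cont: "continuous_on {0..1} \<tau>" using \<tau>(1) by (simp add: path_def)
    define \<gamma>0 where "\<gamma>0 t = \<tau> t *s \<kappa> t" for t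
    have "path \<gamma>0" unfolding path_def \<gamma>0_def by (rule continuous_on_smult[OF \<tau>cont \<kappa>cont])
    define C where "C = (\<lambda>(c, t). c *s \<gamma>0 t) ` (sphere 0 1 \<times> {0..1})"
    have "compact C"
      unfolding C_def case_prod_beta
      by (intro compact_continuous_image continuous_on_smult compact_Times compact_sphere compact_Icc continuous_intros
          continuous_on_compose2[OF \<open>path \<gamma>0\<close>[unfolded path_def]]) auto
    moreover have "C \<subseteq> ?G"
    proof -
      have "c *s \<gamma>0 t \<in> ?G" if "cmod c = 1" "t \<in> {0..1}" for c t
        using good[of "c * \<tau> t" t] \<tau>b[OF that(2)] that by (simp add: \<gamma>0_def norm_mult vector_smult_assoc)
      then show ?thesis by (auto simp: C_def)
    qed
    ultimately obtain e where e: "e > 0" "(\<Union>x\<in>C. ball x e) \<subseteq> ?G"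
      using compact_subset_open_imp_ball_epsilon_subset[OF _ openG] by blast
    obtain \<gamma> where \<gamma>: "polynomial_function \<gamma>" "pathstart \<gamma> = pathstart \<gamma>0" "pathfinish \<gamma> = pathfinish \<gamma>0"
        "\<And>t. t \<in> {0..1} \<Longrightarrow> norm (\<gamma> t - \<gamma>0 t) < e"
      using path_approx_polynomial_function[OF \<open>path \<gamma>0\<close> e(1)] by blast
    have "c *s \<gamma> s \<in> ?G" if "s \<in> {0..1}" "cmod c = 1" for s c
    proof -
      have "dist (c *s \<gamma>0 s) (c *s \<gamma> s) = norm (c *s (\<gamma> s - \<gamma>0 s))"
        by (simp add: dist_norm norm_minus_commute vector_ssub_ldistrib)
      also have "\<dots> = norm (\<gamma> s - \<gamma>0 s)" unfolding norm_vector_smult using that(2) by simp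
      finally have "dist (c *s \<gamma>0 s) (c *s \<gamma> s) < e" using \<gamma>(4)[OF that(1)] by simp
      moreover have "c *s \<gamma>0 s \<in> C" using that by (force simp: C_def)
      ultimately show ?thesis using e(2) by (auto simp: subset_iff)
    qed
    moreover have "\<gamma> 0 = a *s u" "\<gamma> 1 = b *s u'"
      using \<gamma>(2,3) \<tau>(3,4) \<kappa>ends by (simp_all add: pathstart_def pathfinish_def \<gamma>0_def)
    ultimately show "\<exists>\<gamma>. polynomial_function \<gamma> \<and> \<gamma> 0 = a *s u \<and> \<gamma> 1 = b *s u' \<and>
        (\<forall>s\<in>{0..1::real}. \<forall>c. cmod c = 1 \<longrightarrow> c *s \<gamma> s \<in> W \<inter> V \<and> g (c *s \<gamma> s) \<noteq> 0)"
      using \<gamma>(1) by blast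
  qed
qed


section \<open>Monodromy of generic lines\<close>

text \<open>A generic line meets the tangent cone in the origin, and without a reduced equation the cone
  would be empty.\<close>

lemma reduced_equation_of_generic_line:
  assumes "generic_line \<Delta> L"
  obtains g where "reduced_equation \<Delta> g"
proof -
  have "\<forall>\<^sub>F z in nhds 0. z \<in> L \<inter> tangent_cone \<Delta> \<longleftrightarrow> z \<in> {0}"
    using assms by (simp add: generic_line_def germ_eq_def)
  then have "0 \<in> tangent_cone \<Delta>" by (auto dest: eventually_nhds_x_imp_x)
  then show ?thesis using that by (auto simp: tangent_cone_def)
qed

text \<open>Genericity is a condition on germs, so it is a small multiple of a spanning vector that is
  known to lie outside the tangent cone.\<close>

lemma direction_of_generic_line:
  fixes L :: "(complex ^ 'p) set"
  assumes L: "generic_line \<Delta> L" and g: "reduced_equation \<Delta> g"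
  obtains u where "u \<noteq> 0" "initial_form g u \<noteq> 0" "\<And>y. y \<in> L \<Longrightarrow> \<exists>a. y = a *s u"
proof -
  have sub: "vec.subspace L" and dim: "vec.dim L = 1" using L by (auto simp: generic_line_def)
  have "\<forall>\<^sub>F z in nhds 0. z \<in> L \<inter> tangent_cone \<Delta> \<longleftrightarrow> z \<in> {0}"
    using L by (simp add: generic_line_def germ_eq_def)
  then obtain r where r: "r > 0" "\<And>z. norm z < r \<Longrightarrow> z \<in> L \<Longrightarrow> z \<in> tangent_cone \<Delta> \<Longrightarrow> z = 0"
    by (auto simp: eventually_nhds_metric)
  obtain v where v: "v \<in> L" "v \<noteq> 0"
    using dim by (metis vec.dim_eq_0 subsetI singletonI zero_neq_one)
  define c where "c = complex_of_real (r / (2 * norm v))"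
  define u where "u = c *s v"
  have c: "c \<noteq> 0" using r v by (simp add: c_def)
  have uL: "u \<in> L" unfolding u_def by (rule vec.subspace_scale[OF sub v(1)])
  have u0: "u \<noteq> 0" using c v by (simp add: u_def)
  have "norm u = r / 2"
    using r v by (simp add: u_def c_def norm_vector_smult norm_divide norm_mult)
  then have "u \<notin> tangent_cone \<Delta>" using r(2)[of u] r(1) uL u0 by auto
  then have init: "initial_form g u \<noteq> 0" using g by (auto simp: tangent_cone_def)
  have "L \<subseteq> vec.span {u}"
    by (rule vec.card_ge_dim_independent) (use uL u0 dim in auto)
  then have "\<exists>a. y = a *s u" if "y \<in> L" for y
    using that by (auto simp: vec.span_singleton)
  then show ?thesis using that u0 init by blast
qed

lemma has_vector_derivative_rotation:
  "((\<lambda>\<theta>. exp (2 * of_real pi * \<i> * of_real \<theta>) *s y) has_vector_derivative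
    (2 * of_real pi * \<i>) *s (exp (2 * of_real pi * \<i> * of_real \<theta>) *s (y :: complex ^ 'p))) (at \<theta> within S)"
proof -
  have "((\<lambda>\<theta>. exp (2 * of_real pi * \<i> * of_real \<theta>)) has_vector_derivative
      2 * of_real pi * \<i> * exp (2 * of_real pi * \<i> * of_real \<theta>)) (at \<theta> within S)"
    by (rule has_vector_derivative_real_field) (auto intro!: derivative_eq_intros)
  from bounded_linear.has_vector_derivative[OF bounded_linear_smult_left this, of y]
  show ?thesis by (simp add: vector_smult_assoc)
qed

lemma compact_fibre:
  assumes "continuous_on (cball 0 \<epsilon>) \<phi>"
  shows "compact (fibre \<phi> \<epsilon> y)"
proof -
  have "closed (cball 0 \<epsilon> \<inter> \<phi> -` {y})"
    by (intro continuous_closed_preimage assms) auto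
  moreover have "cball 0 \<epsilon> \<inter> \<phi> -` {y} = fibre \<phi> \<epsilon> y" by (auto simp: fibre_def)
  moreover have "bounded (fibre \<phi> \<epsilon> y)"
    by (rule bounded_subset[OF bounded_cball[of 0 \<epsilon>]]) (auto simp: fibre_def)
  ultimately show ?thesis by (simp add: compact_eq_bounded_closed)
qed

text \<open>Both transports are flows over the compact set swept out by the rotations of \<open>\<gamma>\<close>: the one along
  \<open>\<gamma>\<close> lifts the field \<open>\<gamma>'\<close>, and the one along all the circles lifts the rotation field \<open>2 \<pi> \<i> y\<close>.\<close>

lemma transport_along_rotating_path:
  fixes \<phi> :: "complex ^ 'n \<Rightarrow> complex ^ 'p"
  assumes hol: "holomorphic_map_on \<phi> U" and \<epsilon>: "\<epsilon> > 0" "cball 0 (4 * \<epsilon>) \<subseteq> U"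
    and milnor: "milnor_fibration \<phi> \<epsilon> \<delta>"
    and \<gamma>: "polynomial_function \<gamma>"
    and base: "\<And>s c. s \<in> {0..1} \<Longrightarrow> cmod c = 1 \<Longrightarrow> c *s \<gamma> s \<in> milnor_base \<phi> \<epsilon> \<delta>"
  shows "homology_transport \<phi> \<epsilon> q \<gamma> \<in> iso (fibre_homology \<phi> \<epsilon> q (\<gamma> 0)) (fibre_homology \<phi> \<epsilon> q (\<gamma> 1))"
    and "homology_transport \<phi> \<epsilon> q \<gamma> (line_monodromy \<phi> \<epsilon> q (\<gamma> 0) c) =
      line_monodromy \<phi> \<epsilon> q (\<gamma> 1) (homology_transport \<phi> \<epsilon> q \<gamma> c)"
proof -
  obtain D where der: "\<And>x. x \<in> ball 0 (2 * \<epsilon>) \<Longrightarrow> (\<phi> has_derivative blinfun_apply (D x)) (at x)"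
    and Dlip: "bdd_lipschitz_on (ball 0 (2 * \<epsilon>)) D"
    using holomorphic_derivative_bdd_lipschitz[OF hol \<epsilon>] by blast
  have \<phi>cont: "continuous_on (cball 0 \<epsilon>) \<phi>"
    by (intro continuous_at_imp_continuous_on ballI has_derivative_continuous[OF der]) (use \<epsilon> in auto)
  have \<gamma>cont: "continuous_on {0..1} \<gamma>" by (rule continuous_on_polymonial_function[OF \<gamma>])
  define C where "C = (\<lambda>(c, s). c *s \<gamma> s) ` (sphere 0 1 \<times> {0..1})"
  have C: "compact C"
    unfolding C_def case_prod_beta
    by (intro compact_continuous_image continuous_on_smult compact_Times compact_sphere compact_Icc
        continuous_intros continuous_on_compose2[OF \<gamma>cont]) auto
  have CB: "C \<subseteq> milnor_base \<phi> \<epsilon> \<delta>" using base by (auto simp: C_def)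
  have inC: "c *s \<gamma> s \<in> C" if "s \<in> {0..1}" "cmod c = 1" for c s using that by (force simp: C_def)
  have surj: "surj (blinfun_apply (D x))" if "norm x \<le> \<epsilon>" "\<phi> x \<in> C" for x
  proof -
    have "submersion_at \<phi> x"
      using milnor CB that unfolding milnor_fibration_def Let_def by (auto simp: subset_iff)
    then obtain D' where D': "(\<phi> has_derivative D') (at x)" "surj D'" by (auto simp: submersion_at_def)
    have "D' = blinfun_apply (D x)"
      by (rule has_derivative_unique[OF D'(1) der]) (use that \<epsilon> in simp)
    then show ?thesis using D'(2) by simp
  qed
  have bdry: "blinfun_apply (D x) ` {v. x \<bullet> v = 0} = UNIV" if "norm x = \<epsilon>" "\<phi> x \<in> C" for x
  proof -
    have "x \<in> cball 0 \<epsilon> \<inter> \<phi> -` milnor_base \<phi> \<epsilon> \<delta> \<inter> sphere 0 \<epsilon>" using CB that by auto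
    then obtain D' where D': "(\<phi> has_derivative D') (at x)" "D' ` {v. x \<bullet> v = 0} = UNIV"
      using milnor unfolding milnor_fibration_def Let_def by blast
    have "D' = blinfun_apply (D x)"
      by (rule has_derivative_unique[OF D'(1) der]) (use that \<epsilon> in simp)
    then show ?thesis using D'(2) by simp
  qed

  obtain \<gamma>' where \<gamma>': "polynomial_function \<gamma>'" "\<And>t. (\<gamma> has_vector_derivative \<gamma>' t) (at t)"
    using has_vector_derivative_polynomial_function[OF \<gamma>] by blast
  have \<gamma>'cont: "continuous_on {0..1} (\<lambda>t. \<gamma>' t)" by (rule continuous_on_polymonial_function[OF \<gamma>'(1)])
  have solves\<gamma>: "solves_ode (\<lambda>t y. \<gamma>' t) 0 1 \<gamma>"
    unfolding solves_ode_def using \<gamma>'(2) by (auto intro: has_vector_derivative_at_within)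
  have lip0: "norm (\<gamma>' t - \<gamma>' t) \<le> 0 * norm (y - z)" for t and y z :: "complex ^ 'p" by simp
  obtain X where X: "continuous_on ({0..1} \<times> UNIV) (\<lambda>(t, x). X t x)" "\<And>x. X 0 x = x"
    "\<And>c t. solves_ode (\<lambda>t y. \<gamma>' t) 0 1 c \<Longrightarrow> c ` {0..1} \<subseteq> C \<Longrightarrow> t \<in> {0..1} \<Longrightarrow>
       bij_betw (X t) {x \<in> cball 0 \<epsilon>. \<phi> x = c 0} {x \<in> cball 0 \<epsilon>. \<phi> x = c t}"
    using parallel_transport[OF \<epsilon>(1) der Dlip C surj bdry \<gamma>'cont lip0] by blast
  have "\<gamma> ` {0..1} \<subseteq> C" using inC[of _ 1] by auto
  then have trivX: "path_trivialisation \<phi> \<epsilon> \<gamma> X"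
    using X(3)[OF solves\<gamma>] by (intro path_trivialisationI compact_fibre \<phi>cont X(1,2)) (auto simp: fibre_def)

  have lip: "norm ((2 * of_real pi * \<i>) *s y - (2 * of_real pi * \<i>) *s z) \<le> (2 * pi) * norm (y - z)"
    for y z :: "complex ^ 'p"
    by (simp add: norm_vector_smult norm_mult flip: vector_ssub_ldistrib)
  obtain Y where Y: "continuous_on ({0..1} \<times> UNIV) (\<lambda>(t, x). Y t x)" "\<And>x. Y 0 x = x"
    "\<And>c t. solves_ode (\<lambda>t y. (2 * of_real pi * \<i>) *s y) 0 1 c \<Longrightarrow> c ` {0..1} \<subseteq> C \<Longrightarrow> t \<in> {0..1} \<Longrightarrow>
       bij_betw (Y t) {x \<in> cball 0 \<epsilon>. \<phi> x = c 0} {x \<in> cball 0 \<epsilon>. \<phi> x = c t}"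
    using parallel_transport[OF \<epsilon>(1) der Dlip C surj bdry continuous_on_const lip] by blast
  define \<alpha> where "\<alpha> s \<theta> = exp (2 * of_real pi * \<i> * of_real \<theta>) *s \<gamma> s" for s \<theta> :: real
  have \<alpha>ends: "\<alpha> s 0 = \<gamma> s \<and> \<alpha> s 1 = \<gamma> s" for s by (simp add: \<alpha>_def exp_two_pi_i)
  have trivY: "path_trivialisation \<phi> \<epsilon> (\<alpha> s) Y" if s: "s \<in> {0..1}" for s
  proof (rule path_trivialisationI[OF compact_fibre[OF \<phi>cont] Y(1,2)])
    have "solves_ode (\<lambda>t y. (2 * of_real pi * \<i>) *s y) 0 1 (\<alpha> s)"
      unfolding solves_ode_def \<alpha>_def using has_vector_derivative_rotation by blast
    moreover have "\<alpha> s ` {0..1} \<subseteq> C"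
      unfolding \<alpha>_def by (auto intro!: inC[OF s] simp: norm_exp_eq_Re)
    ultimately show "bij_betw (Y t) (fibre \<phi> \<epsilon> (\<alpha> s 0)) (fibre \<phi> \<epsilon> (\<alpha> s t))" if "t \<in> {0..1}" for t
      using Y(3) that by (simp add: fibre_def)
  qed
  have Ycont: "continuous_on UNIV (Y 1)"
  proof -
    have "continuous_on UNIV (\<lambda>x. (\<lambda>(t, x). Y t x) (1, x))"
      by (intro continuous_on_compose2[OF Y(1)] continuous_intros) auto
    then show ?thesis by simp
  qed
  have mono: "line_monodromy \<phi> \<epsilon> q (\<gamma> s) = homology_transport \<phi> \<epsilon> q (\<alpha> s)" for s
    by (simp add: line_monodromy_def \<alpha>_def[abs_def])
  show "homology_transport \<phi> \<epsilon> q \<gamma> \<in> iso (fibre_homology \<phi> \<epsilon> q (\<gamma> 0)) (fibre_homology \<phi> \<epsilon> q (\<gamma> 1))"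
    by (rule homology_transport_iso[OF trivX])
  show "homology_transport \<phi> \<epsilon> q \<gamma> (line_monodromy \<phi> \<epsilon> q (\<gamma> 0) c) =
      line_monodromy \<phi> \<epsilon> q (\<gamma> 1) (homology_transport \<phi> \<epsilon> q \<gamma> c)"
    unfolding mono by (rule transport_conjugates_monodromy[OF trivX \<alpha>ends trivY Ycont])
qed

text \<open>Both lines are tested against one reduced equation \<open>g\<close> of the discriminant. Near the origin the
  points where \<open>g\<close> does not vanish belong to the base of the fibration.\<close>

lemma conjugate_line_monodromies:
  fixes \<phi> :: "complex ^ 'n \<Rightarrow> complex ^ 'p"
  assumes hol: "holomorphic_map_on \<phi> U" and \<epsilon>: "\<epsilon> > 0" "cball 0 (4 * \<epsilon>) \<subseteq> U" and \<delta>: "\<delta> > 0"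
    and milnor: "milnor_fibration \<phi> \<epsilon> \<delta>"
    and L: "generic_line (discriminant \<phi> \<epsilon>) L" and L': "generic_line (discriminant \<phi> \<epsilon>) L'"
  shows "\<exists>\<eta>>0. \<forall>y \<in> L \<inter> ball 0 \<eta> - {0}. \<forall>y' \<in> L' \<inter> ball 0 \<eta> - {0}.
    \<exists>\<gamma>. path \<gamma> \<and> path_image \<gamma> \<subseteq> milnor_base \<phi> \<epsilon> \<delta> \<and> pathstart \<gamma> = y \<and> pathfinish \<gamma> = y' \<and>
      (\<forall>q. homology_transport \<phi> \<epsilon> q \<gamma> \<in> iso (fibre_homology \<phi> \<epsilon> q y) (fibre_homology \<phi> \<epsilon> q y') \<and>
        (\<forall>c \<in> carrier (fibre_homology \<phi> \<epsilon> q y).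
          homology_transport \<phi> \<epsilon> q \<gamma> (line_monodromy \<phi> \<epsilon> q y c) =
          line_monodromy \<phi> \<epsilon> q y' (homology_transport \<phi> \<epsilon> q \<gamma> c)))"
proof -
  obtain g where g: "reduced_equation (discriminant \<phi> \<epsilon>) g" using reduced_equation_of_generic_line[OF L] by blast
  obtain V where V: "open V" "0 \<in> V" "holomorphic_fun_on g V"
    using g by (auto simp: reduced_equation_def holomorphic_germ_def)
  have "\<forall>\<^sub>F z in nhds 0. z \<in> discriminant \<phi> \<epsilon> \<longleftrightarrow> z \<in> {z. g z = 0}"
    using g by (simp add: reduced_equation_def germ_eq_def)
  then obtain N where N: "open N" "0 \<in> N" "\<And>z. z \<in> N \<Longrightarrow> z \<in> discriminant \<phi> \<epsilon> \<longleftrightarrow> g z = 0"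
    by (auto simp: eventually_nhds)
  define k where "k = (LEAST k. \<exists>z. homogeneous_part k g z \<noteq> 0)"
  have init: "initial_form g = homogeneous_part k g" by (simp add: initial_form_def k_def)
  have low: "homogeneous_part j g z = 0" if "j < k" for j z
    using not_less_Least[of j "\<lambda>k. \<exists>z. homogeneous_part k g z \<noteq> 0"] that by (auto simp: k_def)
  obtain u where u: "u \<noteq> 0" "initial_form g u \<noteq> 0" "\<And>y. y \<in> L \<Longrightarrow> \<exists>a. y = a *s u"
    using direction_of_generic_line[OF L g] by blast
  obtain u' where u': "u' \<noteq> 0" "initial_form g u' \<noteq> 0" "\<And>y. y \<in> L' \<Longrightarrow> \<exists>a. y = a *s u'"
    using direction_of_generic_line[OF L' g] by blast
  have W: "open (N \<inter> ball 0 \<delta>)" "0 \<in> N \<inter> ball 0 \<delta>" using N \<delta> by auto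
  obtain \<eta> where \<eta>: "\<eta> > 0"
    "\<And>a b. 0 < cmod a \<Longrightarrow> cmod a < \<eta> \<Longrightarrow> 0 < cmod b \<Longrightarrow> cmod b < \<eta> \<Longrightarrow>
      \<exists>\<gamma>. polynomial_function \<gamma> \<and> \<gamma> 0 = a *s u \<and> \<gamma> 1 = b *s u' \<and>
        (\<forall>s\<in>{0..1::real}. \<forall>c. cmod c = 1 \<longrightarrow> c *s \<gamma> s \<in> (N \<inter> ball 0 \<delta>) \<inter> V \<and> g (c *s \<gamma> s) \<noteq> 0)"
    using path_avoiding_zeros_of_initial_form[OF V(3,1,2) low u(2)[unfolded init] u'(2)[unfolded init] W] by blast
  \<comment> \<open>The vectors \<open>u\<close> and \<open>u'\<close> are not normalised, so the bound on the scalars is rescaled.\<close>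
  define \<eta>0 where "\<eta>0 = \<eta> * min (norm u) (norm u')"
  show ?thesis
  proof (intro exI[of _ \<eta>0] conjI ballI)
    show "\<eta>0 > 0" using \<eta>(1) u(1) u'(1) by (simp add: \<eta>0_def)
    fix y y' assume y: "y \<in> L \<inter> ball 0 \<eta>0 - {0}" and y': "y' \<in> L' \<inter> ball 0 \<eta>0 - {0}"
    obtain a where a: "y = a *s u" using u(3) y by blast
    obtain b where b: "y' = b *s u'" using u'(3) y' by blast
    have le: "\<eta>0 \<le> \<eta> * norm u" "\<eta>0 \<le> \<eta> * norm u'"
      unfolding \<eta>0_def using \<eta>(1) by (auto intro!: mult_left_mono)
    have "cmod a * norm u < \<eta>0" "cmod b * norm u' < \<eta>0" using y y' by (simp_all add: a b norm_vector_smult)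
    then have "cmod a * norm u < \<eta> * norm u" "cmod b * norm u' < \<eta> * norm u'"
      using le by linarith+
    then have "cmod a < \<eta>" "cmod b < \<eta>" using u(1) u'(1) by simp_all
    moreover have "0 < cmod a" "0 < cmod b" using y y' a b by auto
    ultimately obtain \<gamma> where \<gamma>: "polynomial_function \<gamma>" "\<gamma> 0 = y" "\<gamma> 1 = y'"
      "\<And>s c. s \<in> {0..1::real} \<Longrightarrow> cmod c = 1 \<Longrightarrow> c *s \<gamma> s \<in> (N \<inter> ball 0 \<delta>) \<inter> V \<and> g (c *s \<gamma> s) \<noteq> 0"
      using \<eta>(2)[of a b] unfolding a b by blast
    have base: "c *s \<gamma> s \<in> milnor_base \<phi> \<epsilon> \<delta>" if "s \<in> {0..1}" "cmod c = 1" for s c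
      using \<gamma>(4)[OF that] N(3)[of "c *s \<gamma> s"] by (simp add: milnor_base_def)
    have "path \<gamma>" unfolding path_def by (rule continuous_on_polymonial_function[OF \<gamma>(1)])
    moreover have "path_image \<gamma> \<subseteq> milnor_base \<phi> \<epsilon> \<delta>" using base[of _ 1] by (auto simp: path_image_def)
    moreover note transport_along_rotating_path[OF hol \<epsilon> milnor \<gamma>(1) base, unfolded \<gamma>(2,3)]
    ultimately show "\<exists>\<gamma>. path \<gamma> \<and> path_image \<gamma> \<subseteq> milnor_base \<phi> \<epsilon> \<delta> \<and> pathstart \<gamma> = y \<and> pathfinish \<gamma> = y' \<and>
      (\<forall>q. homology_transport \<phi> \<epsilon> q \<gamma> \<in> iso (fibre_homology \<phi> \<epsilon> q y) (fibre_homology \<phi> \<epsilon> q y') \<and>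
        (\<forall>c \<in> carrier (fibre_homology \<phi> \<epsilon> q y).
          homology_transport \<phi> \<epsilon> q \<gamma> (line_monodromy \<phi> \<epsilon> q y c) =
          line_monodromy \<phi> \<epsilon> q y' (homology_transport \<phi> \<epsilon> q \<gamma> c)))"
      using \<gamma>(2,3) by (intro exI[of _ \<gamma>]) (simp add: pathstart_def pathfinish_def)
  qed
qed

theorem lemma2p2:
  fixes \<phi> :: "complex ^ 'n \<Rightarrow> complex ^ 'p" and U :: "(complex ^ 'n) set"
  assumes "open U" and "0 \<in> U" and "holomorphic_map_on \<phi> U" and "\<phi> 0 = 0"
    and "icis \<phi> U"
  shows "\<forall>\<^sub>F \<epsilon> in at_right 0. \<forall>\<^sub>F \<delta> in at_right 0. milnor_fibration \<phi> \<epsilon> \<delta> \<longrightarrow>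
    (\<forall>L L'. generic_line (discriminant \<phi> \<epsilon>) L \<and> generic_line (discriminant \<phi> \<epsilon>) L' \<longrightarrow>
      (\<exists>\<eta>>0. \<forall>y \<in> L \<inter> ball 0 \<eta> - {0}. \<forall>y' \<in> L' \<inter> ball 0 \<eta> - {0}.
        \<exists>\<gamma>. path \<gamma> \<and> path_image \<gamma> \<subseteq> milnor_base \<phi> \<epsilon> \<delta> \<and> pathstart \<gamma> = y \<and> pathfinish \<gamma> = y' \<and>
          (\<forall>q. homology_transport \<phi> \<epsilon> q \<gamma> \<in> iso (fibre_homology \<phi> \<epsilon> q y) (fibre_homology \<phi> \<epsilon> q y') \<and>
            (\<forall>c \<in> carrier (fibre_homology \<phi> \<epsilon> q y).
              homology_transport \<phi> \<epsilon> q \<gamma> (line_monodromy \<phi> \<epsilon> q y c) =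
              line_monodromy \<phi> \<epsilon> q y' (homology_transport \<phi> \<epsilon> q \<gamma> c)))))"
proof -
  obtain r where r: "r > 0" "cball 0 r \<subseteq> U" using assms(1,2) open_contains_cball by blast
  show ?thesis
  proof (rule eventually_at_rightI[of 0 "r / 4"])
    show "0 < r / 4" using r by simp
    fix \<epsilon> assume "\<epsilon> \<in> {0<..<r / 4}"
    then have \<epsilon>: "\<epsilon> > 0" "cball 0 (4 * \<epsilon>) \<subseteq> U" using r(2) by (auto simp: subset_iff)
    show "\<forall>\<^sub>F \<delta> in at_right 0. milnor_fibration \<phi> \<epsilon> \<delta> \<longrightarrow>
      (\<forall>L L'. generic_line (discriminant \<phi> \<epsilon>) L \<and> generic_line (discriminant \<phi> \<epsilon>) L' \<longrightarrow>
      (\<exists>\<eta>>0. \<forall>y \<in> L \<inter> ball 0 \<eta> - {0}. \<forall>y' \<in> L' \<inter> ball 0 \<eta> - {0}.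
        \<exists>\<gamma>. path \<gamma> \<and> path_image \<gamma> \<subseteq> milnor_base \<phi> \<epsilon> \<delta> \<and> pathstart \<gamma> = y \<and> pathfinish \<gamma> = y' \<and>
          (\<forall>q. homology_transport \<phi> \<epsilon> q \<gamma> \<in> iso (fibre_homology \<phi> \<epsilon> q y) (fibre_homology \<phi> \<epsilon> q y') \<and>
            (\<forall>c \<in> carrier (fibre_homology \<phi> \<epsilon> q y).
              homology_transport \<phi> \<epsilon> q \<gamma> (line_monodromy \<phi> \<epsilon> q y c) =
              line_monodromy \<phi> \<epsilon> q y' (homology_transport \<phi> \<epsilon> q \<gamma> c)))))"
      (is "\<forall>\<^sub>F \<delta> in at_right 0. milnor_fibration \<phi> \<epsilon> \<delta> \<longrightarrow>
        (\<forall>L L'. generic_line (discriminant \<phi> \<epsilon>) L \<and> generic_line (discriminant \<phi> \<epsilon>) L' \<longrightarrow> ?concl \<delta> L L')")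
    proof (rule eventually_mono[OF eventually_at_right_less[of 0]], intro impI allI, elim conjE)
      fix \<delta> :: real and L L' :: "(complex ^ 'p) set"
      assume \<delta>: "0 < \<delta>" and milnor: "milnor_fibration \<phi> \<epsilon> \<delta>"
        and L: "generic_line (discriminant \<phi> \<epsilon>) L" and L': "generic_line (discriminant \<phi> \<epsilon>) L'"
      show "?concl \<delta> L L'"
        using conjugate_line_monodromies[OF assms(3) \<epsilon> \<delta> milnor L L'] by blast
    qed
  qed
qed

end
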